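(* Let $n,m\ge 1$ be integers. The surjection $\mathbb{C}[\mathrm{rep}(A_m,n)]\to\mathbb{C}[V^m]$ induced by the embedding of the space $V^m$ of $m$-tuples of diagonal $n\times n$ matrices into the commuting variety restricts to an isomorphism $$\mathbb{C}[\mathrm{rep}(A_m,n)]^{GL(n,\mathbb{C})}\cong\mathbb{C}[V^m]^{S_n}.$$ In particular, the (nil)radical of $\mathbb{C}[\mathrm{rep}(A_m,n)]$ contains no non-zero $GL(n,\mathbb{C})$-invariants.
   Context: Let $\mathbb{C}[\mathrm{rep}(F_m,n)]$ be the polynomial algebra over $\mathbb{C}$ in the $n^2m$ entries of the generic $n\times n$ matrices $Y(1),\ldots,Y(m)$, i.e. the coordinate ring of the space of $m$-tuples of complex $n\times n$ matrices, on which $GL(n,\mathbb{C})$ acts by simultaneous conjugation. Let $J$ be the ideal generated by all entries of the commutators $Y(i)Y(j)-Y(j)Y(i)$, $1\le i<j\le m$; it is $GL(n,\mathbb{C})$-stable. Define $\mathbb{C}[\mathrm{rep}(A_m,n)]=\mathbb{C}[\mathrm{rep}(F_m,n)]/J$, the coordinate ring of the scheme of $n$-dimensional representations of the commutative polynomial algebra $A_m=\mathbb{C}[x(1),\ldots,x(m)]$, with the induced $GL(n,\mathbb{C})$-action. The commuting variety is the common zero locus of $J$, i.e. the set of $m$-tuples of pairwise commuting $n\times n$ matrices. $V=\mathbb{C}^n$ is identified with the space of diagonal $n\times n$ matrices, and $\mathbb{C}[V^m]$ is the polynomial ring in variables $x(i)_j$ ($1\le i\le m$, $1\le j\le n$),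 with $S_n$ acting by simultaneously permuting the index $j$. The surjection $\mathbb{C}[\mathrm{rep}(A_m,n)]\to\mathbb{C}[V^m]$ sends $Y(i)$ entrywise to the generic diagonal matrix $\mathrm{diag}(x(i)_1,\ldots,x(i)_n)$. *)

theory Defs
  imports
    "HOL-Analysis.Analysis"
    "HOL-Library.Poly_Mapping"
    "HOL-Algebra.Algebraic_Closure_Type"
begin

section \<open>Complex polynomials in several variables\<close>

text \<open>
  The polynomial algebra over the complex numbers in variables indexed by \<^typ>\<open>'v\<close>: finitely
  supported functions from exponent vectors to coefficients, with convolution as product.
\<close>

type_synonym 'v cpoly = "('v \<Rightarrow>\<^sub>0 nat) \<Rightarrow>\<^sub>0 complex"

definition Const :: "complex \<Rightarrow> 'v cpoly"
  where "Const c = Poly_Mapping.single 0 c"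

definition Var :: "'v \<Rightarrow> 'v cpoly"
  where "Var v = Poly_Mapping.single (Poly_Mapping.single v 1) 1"

text \<open>The algebra homomorphism with \<open>Var v \<mapsto> \<sigma> v\<close>.\<close>

definition subst :: "('v \<Rightarrow> 'w cpoly) \<Rightarrow> 'v cpoly \<Rightarrow> 'w cpoly"
  where "subst \<sigma> p =
    (\<Sum>a\<in>Poly_Mapping.keys p. Const (Poly_Mapping.lookup p a) *
       (\<Prod>v\<in>Poly_Mapping.keys a. \<sigma> v ^ Poly_Mapping.lookup a v))"


section \<open>The coordinate ring of the scheme of representations of \<open>A\<^sub>m\<close>\<close>

text \<open>
  The finite types \<^typ>\<open>'m\<close> and \<^typ>\<open>'n\<close> index the \<open>m \<ge> 1\<close> matrices and their \<open>n \<ge> 1\<close> rows and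
  columns.  The variable \<open>(k, i, j)\<close> stands for the \<open>(i, j)\<close> entry of \<open>Y(k)\<close>, so that
  \<open>\<complex>[rep(F\<^sub>m, n)]\<close> is the whole type \<open>('m, 'n) rep_poly\<close>.
\<close>

type_synonym ('m, 'n) rep_poly = "('m \<times> 'n \<times> 'n) cpoly"

definition generic_matrix :: "'m \<Rightarrow> ('m, 'n::finite) rep_poly ^ 'n ^ 'n"
  where "generic_matrix k = (\<chi> i j. Var (k, i, j))"

text \<open>
  All pairs \<open>(k, l)\<close> are allowed; compared with \<open>k < l\<close> this only adds zeros and negatives of
  generators, and avoids choosing an order on the index type.
\<close>

definition commutator_entries :: "('m::finite, 'n::finite) rep_poly set"
  where "commutator_entries =
    {(generic_matrix k ** generic_matrix l - generic_matrix l ** generic_matrix k) $ i $ j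
      | k l i j. True}"

definition comm_ideal :: "('m::finite, 'n::finite) rep_poly set"
  where "comm_ideal = Idl\<^bsub>ring_of_type_algebra\<^esub> commutator_entries"

definition rep_ring :: "('m::finite, 'n::finite) rep_poly set ring"
  where "rep_ring = ring_of_type_algebra Quot comm_ideal"

text \<open>
  The (left) action of \<open>g \<in> GL(n, \<complex>)\<close> on functions: \<open>(g \<cdot> f)(Y) = f(g\<^sup>-\<^sup>1 Y g)\<close>, that is,
  \<open>Y(k)\<close> is replaced entrywise by \<open>g\<^sup>-\<^sup>1 Y(k) g\<close>.
\<close>

definition GL_act :: "complex ^ 'n ^ 'n \<Rightarrow> ('m, 'n::finite) rep_poly \<Rightarrow> ('m, 'n) rep_poly"
  where "GL_act g = subst (\<lambda>(k, i, j).
    (map_matrix Const (matrix_inv g) ** generic_matrix k ** map_matrix Const g) $ i $ j)"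

text \<open>
  As \<^const>\<open>comm_ideal\<close> is stable under the action, the induced action on the quotient maps a coset
  to its image.
\<close>

definition GL_invariants :: "('m::finite, 'n::finite) rep_poly set set"
  where "GL_invariants =
    {U \<in> carrier rep_ring. \<forall>g :: complex ^ 'n ^ 'n. invertible g \<longrightarrow> GL_act g ` U = U}"


section \<open>Restriction to tuples of diagonal matrices\<close>

text \<open>The variable \<open>(k, j)\<close> stands for \<open>x(k)\<^sub>j\<close>.\<close>

type_synonym ('m, 'n) diag_poly = "('m \<times> 'n) cpoly"

definition diag_subst :: "('m, 'n) rep_poly \<Rightarrow> ('m, 'n) diag_poly"
  where "diag_subst = subst (\<lambda>(k, i, j). if i = j then Var (k, i) else 0)"

text \<open>
  The map induced by \<^const>\<open>diag_subst\<close> on the quotient: the common value on a coset (compare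
  the first isomorphism theorem in \<^theory>\<open>HOL-Algebra.QuotRing\<close>).
\<close>

definition diag_restriction :: "('m, 'n) rep_poly set \<Rightarrow> ('m, 'n) diag_poly"
  where "diag_restriction U = the_elem (diag_subst ` U)"

definition Sn_act :: "('n \<Rightarrow> 'n) \<Rightarrow> ('m, 'n) diag_poly \<Rightarrow> ('m, 'n) diag_poly"
  where "Sn_act \<pi> = subst (\<lambda>(k, j). Var (k, \<pi> j))"

definition Sn_invariants :: "('m, 'n) diag_poly set"
  where "Sn_invariants = {f. \<forall>\<pi>. \<pi> permutes UNIV \<longrightarrow> Sn_act \<pi> f = f}"


section \<open>The nilradical\<close>

definition nilradical :: "('a, 'b) ring_scheme \<Rightarrow> 'a set"
  where "nilradical R = {a \<in> carrier R. \<exists>k::nat. a [^]\<^bsub>R\<^esub> k = \<zero>\<^bsub>R\<^esub>}"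

end

theory Submission
  imports Defs
begin

text \<open>
  Injectivity comes from a linear map \<open>S\<close> (\<open>trace_section\<close> below) back from \<open>\<complex>[V\<^sup>m]\<close>, given on monomials by
  \<open>S(x\<^sub>1\<^bsup>a(1)\<^esup> \<cdots> x\<^sub>n\<^bsup>a(n)\<^esup>) = D(Y\<^bsup>a(1)\<^esup>, \<dots>, Y\<^bsup>a(n)\<^esup>) / n!\<close> with \<open>D\<close> the mixed discriminant, the
  polarised determinant.  The derivative of \<open>det ((1 + \<epsilon>B) N) = det (1 + \<epsilon>B) det N\<close> at \<open>\<epsilon> = 0\<close> yields
  \<open>\<Sum>\<^sub>j D(\<dots>, B M\<^sub>j, \<dots>) = tr(B) D(M\<^sub>1, \<dots>, M\<^sub>n)\<close>, so modulo the commutators \<open>S\<close> turns multiplication by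
  a power sum into multiplication by the corresponding trace, and \<open>S\<close> undoes the restriction on
  products of traces.  Restricting \<open>S(h)\<close> to diagonal matrices averages \<open>h\<close> over \<open>S\<^sub>n\<close>, and \<open>S(h)\<close> is
  \<open>GL(n)\<close>-invariant because \<open>D\<close> is multiplicative; this gives surjectivity.

  It remains to see that products of traces span the invariants of the quotient.  Lifting a polynomial
  to a tensor, the tensors representing elements of the ideal have a \<open>GL(n)\<close>-stable orthogonal
  complement, as \<open>GL(n)\<close> is closed under adjoints; hence an invariant coset is represented by an
  invariant tensor, which by Schur--Weyl duality is a combination of permutation operators.
\<close>

text \<open>The commutator ideal is not known to be radical, so an identity in the quotient cannot
  be checked at tuples of commuting matrices: every step has to be an identity of polynomials, up to
  explicit elements of the ideal. This is why injectivity rests on a map back that is written down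
  on monomials. That map is linear but not multiplicative, and its value on a monomial involves
  words in the generic matrices whose order matters until commutators are divided out. It need not
  invert the restriction everywhere: fixing 1 and turning power sums into traces already determine
  it on products of traces. The factor n! is the mixed discriminant of n identity matrices. The
  derivative of the determinant is replaced by a column-by-column identity, valid over any
  commutative ring. Invariance is given only modulo the ideal, whereas Schur--Weyl duality needs an
  exactly invariant tensor. A Hermitian projection supplies it without averaging over a group: the
  part of a lift orthogonal to all lifts of ideal elements is fixed on the nose. The statement on
  nilpotents follows from injectivity, since polynomials over the complex numbers form a
  domain.\<close>

no_notation fps_nth (infixl \<open>$\<close> 75)
no_notation m_inv (\<open>(\<open>open_block notation=\<open>prefix inv\<close>\<close>inv\<index> _)\<close> [81] 80)

section \<open>Polynomials and substitutions\<close>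

text \<open>Separated from \<open>subst\<close> because the section of the restriction map
  prescribes values on monomials that are not multiplicative in the exponent; \<open>subst\<close>
  is the case of multiplicative values.\<close>

definition linear_extension :: "(('v \<Rightarrow>\<^sub>0 nat) \<Rightarrow> 'w cpoly) \<Rightarrow> 'v cpoly \<Rightarrow> 'w cpoly"
  where "linear_extension F p =
    (\<Sum>a\<in>Poly_Mapping.keys p. Const (Poly_Mapping.lookup p a) * F a)"

definition monomial_value :: "('v \<Rightarrow> 'w cpoly) \<Rightarrow> ('v \<Rightarrow>\<^sub>0 nat) \<Rightarrow> 'w cpoly"
  where "monomial_value \<sigma> a = (\<Prod>v\<in>Poly_Mapping.keys a. \<sigma> v ^ Poly_Mapping.lookup a v)"

lemma subst_eq_linear_extension: "subst \<sigma> = linear_extension (monomial_value \<sigma>)"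
  by (simp add: fun_eq_iff subst_def linear_extension_def monomial_value_def)

lemma Const_0 [simp]: "Const 0 = 0"
  and Const_1 [simp]: "Const 1 = 1"
  and Const_add: "Const (c + d) = Const c + Const d"
  and Const_diff: "Const (c - d) = Const c - Const d"
  and Const_mult: "Const (c * d) = Const c * Const d"
  by (simp_all add: Const_def single_add single_diff mult_single)

lemma Const_sum: "Const (sum f A) = (\<Sum>x\<in>A. Const (f x))"
  by (induction A rule: infinite_finite_induct) (simp_all add: Const_add)

lemma Const_prod: "Const (prod f A) = (\<Prod>x\<in>A. Const (f x))"
  by (induction A rule: infinite_finite_induct) (simp_all add: Const_mult)

lemma Const_of_nat: "Const (of_nat n) = of_nat n"
  by (induction n) (simp_all add: Const_add)

lemma Const_mult_single: "Const c * Poly_Mapping.single a d = Poly_Mapping.single a (c * d)"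
  by (simp add: Const_def mult_single)

lemma cpoly_eq_sum_single:
  "(\<Sum>a\<in>Poly_Mapping.keys p. Poly_Mapping.single a (Poly_Mapping.lookup p a)) = p"
proof (rule poly_mapping_eqI)
  fix b
  have "Poly_Mapping.lookup (\<Sum>a\<in>Poly_Mapping.keys p. Poly_Mapping.single a (Poly_Mapping.lookup p a)) b
      = (\<Sum>a\<in>Poly_Mapping.keys p. if a = b then Poly_Mapping.lookup p b else 0)"
    unfolding lookup_sum by (intro sum.cong refl) (auto simp: lookup_single)
  also have "\<dots> = Poly_Mapping.lookup p b"
    by (simp add: in_keys_iff)
  finally show "Poly_Mapping.lookup (\<Sum>a\<in>Poly_Mapping.keys p. Poly_Mapping.single a (Poly_Mapping.lookup p a)) b
      = Poly_Mapping.lookup p b" .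
qed

lemma linear_extension_superset:
  assumes "finite K" "Poly_Mapping.keys p \<subseteq> K"
  shows "linear_extension F p = (\<Sum>a\<in>K. Const (Poly_Mapping.lookup p a) * F a)"
  unfolding linear_extension_def using assms
  by (intro sum.mono_neutral_left) (auto simp: in_keys_iff)

lemma linear_extension_add:
  "linear_extension F (p + q) = linear_extension F p + linear_extension F q"
proof -
  let ?K = "Poly_Mapping.keys p \<union> Poly_Mapping.keys q"
  have "Poly_Mapping.keys (p + q) \<subseteq> ?K"
    by (rule keys_add)
  then show ?thesis
    by (simp add: linear_extension_superset[of ?K] lookup_add Const_add distrib_right sum.distrib)
qed

lemma linear_extension_0 [simp]: "linear_extension F 0 = 0"
  by (simp add: linear_extension_def)

lemma linear_extension_uminus: "linear_extension F (- p) = - linear_extension F p"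
  using linear_extension_add[of F p "- p"] by (simp add: eq_neg_iff_add_eq_0 add.commute)

lemma linear_extension_diff:
  "linear_extension F (p - q) = linear_extension F p - linear_extension F q"
  using linear_extension_add[of F p "- q"] by (simp add: linear_extension_uminus)

lemma linear_extension_sum:
  "linear_extension F (sum f A) = (\<Sum>x\<in>A. linear_extension F (f x))"
  by (induction A rule: infinite_finite_induct) (simp_all add: linear_extension_add)

lemma linear_extension_single:
  "linear_extension F (Poly_Mapping.single a c) = Const c * F a"
  by (simp add: linear_extension_superset[of "{a}"])

lemma cpoly_induct [case_names single add]:
  assumes "\<And>a c. P (Poly_Mapping.single a c)" "\<And>p q. P p \<Longrightarrow> P q \<Longrightarrow> P (p + q)"
  shows "P (p :: 'v cpoly)"
proof -
  have "P (\<Sum>a\<in>A. Poly_Mapping.single a (Poly_Mapping.lookup p a))"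
    if "finite A" for A
    using that
  proof induction
    case empty
    then show ?case using assms(1)[of 0 0] by simp
  next
    case (insert x F)
    then show ?case by (simp add: assms)
  qed
  from this[of "Poly_Mapping.keys p"] show ?thesis
    by (simp add: cpoly_eq_sum_single)
qed

lemma linear_extension_Const_mult:
  "linear_extension F (Const c * p) = Const c * linear_extension F p"
  by (induction p rule: cpoly_induct)
    (simp_all add: Const_mult_single linear_extension_single Const_mult mult.assoc
      linear_extension_add distrib_left)

lemma monomial_value_superset:
  assumes "finite K" "Poly_Mapping.keys a \<subseteq> K"
  shows "monomial_value \<sigma> a = (\<Prod>v\<in>K. \<sigma> v ^ Poly_Mapping.lookup a v)"
  unfolding monomial_value_def using assms
  by (intro prod.mono_neutral_left) (auto simp: in_keys_iff)

lemma monomial_value_add: "monomial_value \<sigma> (a + b) = monomial_value \<sigma> a * monomial_value \<sigma> b"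
proof -
  let ?K = "Poly_Mapping.keys a \<union> Poly_Mapping.keys b"
  have "Poly_Mapping.keys (a + b) \<subseteq> ?K"
    by (rule keys_add)
  then show ?thesis
    by (simp add: monomial_value_superset[of ?K] lookup_add power_add prod.distrib)
qed

lemma monomial_value_0 [simp]: "monomial_value \<sigma> 0 = 1"
  by (simp add: monomial_value_def)

lemma monomial_value_single: "monomial_value \<sigma> (Poly_Mapping.single v k) = \<sigma> v ^ k"
  by (simp add: monomial_value_superset[of "{v}"])

lemma subst_0 [simp]: "subst \<sigma> 0 = 0"
  and subst_add: "subst \<sigma> (p + q) = subst \<sigma> p + subst \<sigma> q"
  and subst_diff: "subst \<sigma> (p - q) = subst \<sigma> p - subst \<sigma> q"
  and subst_sum: "subst \<sigma> (sum f A) = (\<Sum>x\<in>A. subst \<sigma> (f x))"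
  and subst_single: "subst \<sigma> (Poly_Mapping.single a c) = Const c * monomial_value \<sigma> a"
  by (simp_all add: subst_eq_linear_extension linear_extension_add linear_extension_diff
      linear_extension_sum linear_extension_single)

lemma subst_Const [simp]: "subst \<sigma> (Const c) = Const c"
  by (simp add: Const_def[of c] subst_single)

lemma subst_1 [simp]: "subst \<sigma> 1 = 1"
  using subst_Const[of \<sigma> 1] by simp

lemma subst_Var [simp]: "subst \<sigma> (Var v) = \<sigma> v"
  by (simp add: Var_def subst_single monomial_value_single)

lemma subst_mult: "subst \<sigma> (p * q) = subst \<sigma> p * subst \<sigma> q"
proof (induction p rule: cpoly_induct)
  case (single a c)
  show ?case
    by (induction q rule: cpoly_induct)
      (simp_all add: mult_single subst_single subst_add Const_mult monomial_value_add algebra_simps)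
qed (simp add: subst_add distrib_right)

lemma subst_prod: "subst \<sigma> (prod f A) = (\<Prod>x\<in>A. subst \<sigma> (f x))"
  by (induction A rule: infinite_finite_induct) (simp_all add: subst_mult)

lemma subst_power: "subst \<sigma> (p ^ k) = subst \<sigma> p ^ k"
  by (induction k) (simp_all add: subst_mult)

lemma subst_of_int [simp]: "subst \<sigma> (of_int k) = of_int k"
  by (cases k rule: int_diff_cases)
    (metis Const_of_nat of_int_diff of_int_of_nat_eq subst_Const subst_diff)

lemma subst_monomial_value:
  "subst \<tau> (monomial_value \<sigma> a) = monomial_value (\<lambda>v. subst \<tau> (\<sigma> v)) a"
  by (simp add: monomial_value_def subst_prod subst_power)

lemma subst_subst: "subst \<tau> (subst \<sigma> p) = subst (\<lambda>v. subst \<tau> (\<sigma> v)) p"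
  by (induction p rule: cpoly_induct)
    (simp_all add: subst_single subst_add subst_mult subst_monomial_value)

lemma single_eq_monomial_value:
  "Poly_Mapping.single a c = Const c * monomial_value Var a"
proof -
  have "monomial_value Var a = Poly_Mapping.single a 1"
  proof -
    have pow: "Var v ^ k = Poly_Mapping.single (Poly_Mapping.single v k) 1" for v :: 'a and k
      by (induction k) (simp_all add: Var_def mult_single flip: single_add)
    have "(\<Prod>v\<in>A. Poly_Mapping.single (f v) (1 :: complex)) = Poly_Mapping.single (\<Sum>v\<in>A. f v) 1"
      for A :: "'a set" and f :: "'a \<Rightarrow> 'a \<Rightarrow>\<^sub>0 nat"
      by (induction A rule: infinite_finite_induct) (simp_all add: mult_single)
    moreover have "(\<Sum>v\<in>Poly_Mapping.keys a. Poly_Mapping.single v (Poly_Mapping.lookup a v)) = a"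
      by (rule poly_mapping_eqI)
        (simp add: lookup_sum lookup_single when_def in_keys_iff)
    ultimately show ?thesis
      by (simp add: monomial_value_def pow)
  qed
  then show ?thesis
    by (simp add: Const_mult_single)
qed

lemma subst_Var_id [simp]: "subst Var p = p"
proof (induction p rule: cpoly_induct)
  case (single a c)
  show ?case by (metis subst_single single_eq_monomial_value)
qed (simp add: subst_add)

section \<open>Ideals and cosets in a commutative ring given as a type\<close>

lemma ring_of_type_algebra_simps [simp]:
  "carrier ring_of_type_algebra = UNIV"
  "x \<otimes>\<^bsub>ring_of_type_algebra\<^esub> y = x * y"
  "x \<oplus>\<^bsub>ring_of_type_algebra\<^esub> y = x + y"
  "\<one>\<^bsub>ring_of_type_algebra\<^esub> = 1"
  "\<zero>\<^bsub>ring_of_type_algebra\<^esub> = 0"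
  by (simp_all add: ring_of_type_algebra_def)

lemma a_inv_ring_of_type_algebra [simp]:
  "\<ominus>\<^bsub>ring_of_type_algebra\<^esub> x = - (x :: 'a :: comm_ring_1)"
proof -
  interpret R: cring "ring_of_type_algebra :: 'a ring"
    by (rule cring_from_type_algebra)
  show ?thesis
    using R.minus_equality[of "- x" x] by simp
qed

lemma ideal_ring_of_type_algebraI:
  fixes K :: "'a :: comm_ring_1 set"
  assumes "0 \<in> K" "\<And>x y. x \<in> K \<Longrightarrow> y \<in> K \<Longrightarrow> x + y \<in> K" "\<And>x y. x \<in> K \<Longrightarrow> y * x \<in> K"
  shows "ideal K ring_of_type_algebra"
proof -
  interpret R: cring "ring_of_type_algebra :: 'a ring"
    by (rule cring_from_type_algebra)
  have "- x \<in> K" if "x \<in> K" for x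
    using assms(3)[OF that, of "- 1"] by simp
  then have "subgroup K (add_monoid (ring_of_type_algebra :: 'a ring))"
    using assms by (intro R.add.subgroupI) (auto simp: a_inv_def[symmetric])
  then show ?thesis
    using assms by (intro idealI R.ring_axioms) (auto simp: mult.commute)
qed

context
  fixes J :: "'a :: comm_ring_1 set"
  assumes J: "ideal J ring_of_type_algebra"
begin

lemmas ideal_subgroup_facts =
  additive_subgroup.a_closed[OF ideal.axioms(1)[OF J]]
  additive_subgroup.zero_closed[OF ideal.axioms(1)[OF J]]

lemma ideal_add: "x \<in> J \<Longrightarrow> y \<in> J \<Longrightarrow> x + y \<in> J"
  using ideal_subgroup_facts by simp

lemma ideal_zero: "0 \<in> J"
  using ideal_subgroup_facts by simp

lemma ideal_mult_left: "x \<in> J \<Longrightarrow> y * x \<in> J"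
  using ideal.I_l_closed[OF J] by simp

lemma ideal_mult_right: "x \<in> J \<Longrightarrow> x * y \<in> J"
  using ideal.I_r_closed[OF J] by simp

lemma ideal_uminus: "x \<in> J \<Longrightarrow> - x \<in> J"
  using ideal_mult_left[of x "- 1"] by simp

lemma ideal_diff: "x \<in> J \<Longrightarrow> y \<in> J \<Longrightarrow> x - y \<in> J"
  using ideal_add[of x "- y"] ideal_uminus by simp

lemma ideal_sum: "(\<And>i. i \<in> A \<Longrightarrow> f i \<in> J) \<Longrightarrow> sum f A \<in> J"
  by (induction A rule: infinite_finite_induct) (auto simp: ideal_zero ideal_add)

lemma ideal_mult_cong: "x - x' \<in> J \<Longrightarrow> y - y' \<in> J \<Longrightarrow> x * y - x' * y' \<in> J"
  using ideal_add[OF ideal_mult_right[of "x - x'" y] ideal_mult_left[of "y - y'" x']]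
  by (simp add: algebra_simps)

lemma ideal_sum_cong: "(\<And>i. i \<in> A \<Longrightarrow> f i - g i \<in> J) \<Longrightarrow> sum f A - sum g A \<in> J"
  using ideal_sum[of A "\<lambda>i. f i - g i"] by (simp add: sum_subtractf)

lemma ideal_prod_cong: "(\<And>i. i \<in> A \<Longrightarrow> f i - g i \<in> J) \<Longrightarrow> prod f A - prod g A \<in> J"
  by (induction A rule: infinite_finite_induct) (auto simp: ideal_zero intro!: ideal_mult_cong)

lemma ideal_trans: "x - y \<in> J \<Longrightarrow> y - z \<in> J \<Longrightarrow> x - z \<in> J"
  using ideal_add[of "x - y" "y - z"] by simp

lemma ideal_sym: "x - y \<in> J \<Longrightarrow> y - x \<in> J"
  using ideal_uminus[of "x - y"] by simp

lemma coset_eq: "J +>\<^bsub>ring_of_type_algebra\<^esub> x = {y. y - x \<in> J}"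
proof -
  have "y \<in> (\<lambda>h. h + x) ` J" if "y - x \<in> J" for y
    using that by (intro image_eqI[of _ _ "y - x"]) auto
  then show ?thesis
    by (auto simp: a_r_coset_def')
qed

lemma coset_eq_iff:
  "J +>\<^bsub>ring_of_type_algebra\<^esub> x = J +>\<^bsub>ring_of_type_algebra\<^esub> y \<longleftrightarrow> x - y \<in> J"
proof
  assume "J +>\<^bsub>ring_of_type_algebra\<^esub> x = J +>\<^bsub>ring_of_type_algebra\<^esub> y"
  moreover have "x \<in> {y. y - x \<in> J}"
    by (simp add: ideal_zero)
  ultimately show "x - y \<in> J"
    unfolding coset_eq by blast
next
  assume "x - y \<in> J"
  then show "J +>\<^bsub>ring_of_type_algebra\<^esub> x = J +>\<^bsub>ring_of_type_algebra\<^esub> y"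
    unfolding coset_eq using ideal_trans ideal_sym by blast
qed

end

text \<open>The preimage of \<open>K\<close> under the substitution is an ideal containing
  \<open>S\<close>. It serves twice: with \<open>K\<close> the commutator ideal for its stability,
  and with \<open>K\<close> zero for its vanishing on diagonal matrices.\<close>

lemma subst_genideal:
  assumes "ideal K ring_of_type_algebra" "\<And>s. s \<in> S \<Longrightarrow> subst \<sigma> s \<in> K"
    and "x \<in> Idl\<^bsub>ring_of_type_algebra\<^esub> S"
  shows "subst \<sigma> x \<in> K"
proof -
  have "ideal {x. subst \<sigma> x \<in> K} ring_of_type_algebra"
    by (rule ideal_ring_of_type_algebraI)
      (auto simp: subst_add subst_mult ideal_zero[OF assms(1)] ideal_add[OF assms(1)]
        ideal_mult_left[OF assms(1)])
  then have "Idl\<^bsub>ring_of_type_algebra\<^esub> S \<subseteq> {x. subst \<sigma> x \<in> K}"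
    using assms(2) by (intro ring.genideal_minimal ring_from_type_algebra) auto
  then show ?thesis using assms(3) by auto
qed

section \<open>Schur--Weyl duality\<close>

lemma sum_cnj_mult_self_eq_0:
  assumes "finite L" "(\<Sum>x\<in>L. cnj (u x) * u x) = 0" "x \<in> L"
  shows "u x = 0"
proof -
  have "(\<Sum>x\<in>L. cnj (u x) * u x) = of_real (\<Sum>x\<in>L. (norm (u x))\<^sup>2)"
    unfolding of_real_sum
    by (intro sum.cong refl) (metis complex_norm_square mult.commute of_real_power)
  then have "(\<Sum>x\<in>L. (norm (u x))\<^sup>2) = 0"
    using assms(2) by (metis of_real_eq_0_iff)
  then show ?thesis
    using assms by (simp add: sum_nonneg_eq_0_iff)
qed

text \<open>Induction on the coordinates. The vectors of \<open>V\<close> vanishing at the new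
  coordinate \<open>y\<close> form a subspace of codimension at most one, whose inner products only
  see the old coordinates; at most one Gram--Schmidt step is then left.\<close>

lemma orthogonal_projection_exists:
  fixes V :: "('x \<Rightarrow> complex) set"
  assumes "finite L"
    and "(\<lambda>_. 0) \<in> V" "\<And>u v. u \<in> V \<Longrightarrow> v \<in> V \<Longrightarrow> (\<lambda>x. u x + v x) \<in> V"
    and "\<And>c u. u \<in> V \<Longrightarrow> (\<lambda>x. c * u x) \<in> V"
  shows "\<exists>v\<in>V. \<forall>u\<in>V. (\<Sum>x\<in>L. cnj (u x) * (f x - v x)) = 0"
  using assms
proof (induction L arbitrary: V f rule: finite_induct)
  case empty
  then show ?case by auto
next
  case (insert y L)
  let ?ip = "\<lambda>K u v. \<Sum>x\<in>K. cnj (u x) * v x"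
  define V' where "V' = {u \<in> V. u y = 0}"
  have IH: "\<exists>v\<in>V'. \<forall>u\<in>V'. ?ip (insert y L) u (\<lambda>x. f x - v x) = 0" for f
  proof -
    have "\<exists>v\<in>V'. \<forall>u\<in>V'. (\<Sum>x\<in>L. cnj (u x) * (f x - v x)) = 0"
      by (rule insert.IH) (use insert.prems in \<open>auto simp: V'_def\<close>)
    moreover have "?ip (insert y L) u (\<lambda>x. f x - v x) = ?ip L u (\<lambda>x. f x - v x)"
      if "u \<in> V'" for u v
      using insert.hyps that by (simp add: V'_def)
    ultimately show ?thesis by simp
  qed
  obtain v1 where v1: "v1 \<in> V'" "\<And>u. u \<in> V' \<Longrightarrow> ?ip (insert y L) u (\<lambda>x. f x - v1 x) = 0"
    using IH by blast
  show ?case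
  proof (cases "V' = V")
    case True
    then show ?thesis using v1 by blast
  next
    case False
    then obtain u1 where u1: "u1 \<in> V" "u1 y \<noteq> 0"
      by (auto simp: V'_def)
    define u0 where "u0 = (\<lambda>x. 1 / u1 y * u1 x)"
    have u0: "u0 \<in> V" "u0 y = 1"
      unfolding u0_def using insert.prems(3)[OF u1(1), of "1 / u1 y"] u1(2) by simp_all
    obtain v0 where v0: "v0 \<in> V'" "\<And>u. u \<in> V' \<Longrightarrow> ?ip (insert y L) u (\<lambda>x. u0 x - v0 x) = 0"
      using IH[of u0] by blast
    define w0 where "w0 = (\<lambda>x. u0 x + (- 1) * v0 x)"
    have v0': "v0 \<in> V" "v0 y = 0"
      using v0(1) by (auto simp: V'_def)
    have w0: "w0 \<in> V" "w0 y = 1"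
      unfolding w0_def
      by (rule insert.prems(2)[OF u0(1) insert.prems(3)[OF v0'(1)]]) (simp add: u0(2) v0'(2))
    have w0_orth: "?ip (insert y L) u w0 = 0" if "u \<in> V'" for u
      using v0(2)[OF that] by (simp add: w0_def)
    have w0_ne: "?ip (insert y L) w0 w0 \<noteq> 0"
      using sum_cnj_mult_self_eq_0[of "insert y L" w0 y] insert.hyps w0(2) by auto
    \<comment> \<open>The Fourier coefficient along \<open>w0\<close>, a vector of \<open>V\<close>
      orthogonal to \<open>V'\<close> and normalised to be 1 at \<open>y\<close>. Each
      \<open>u\<close> in \<open>V\<close> is then a vector of \<open>V'\<close> plus
      \<open>u y\<close> times \<open>w0\<close>.\<close>
    define c where "c = ?ip (insert y L) w0 (\<lambda>x. f x - v1 x) / ?ip (insert y L) w0 w0"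
    define v where "v = (\<lambda>x. v1 x + c * w0 x)"
    have "v \<in> V"
      using v1(1) insert.prems(2)[OF _ insert.prems(3)[OF w0(1)]] by (auto simp: v_def V'_def)
    moreover have "?ip (insert y L) u (\<lambda>x. f x - v x) = 0" if u: "u \<in> V" for u
    proof -
      define u' where "u' = (\<lambda>x. u x + (- u y) * w0 x)"
      have u': "u' \<in> V'"
        using insert.prems(2)[OF u insert.prems(3)[OF w0(1), of "- u y"]] w0(2)
        unfolding V'_def u'_def by simp
      have split: "?ip K a (\<lambda>x. f x - v x) = ?ip K a (\<lambda>x. f x - v1 x) - c * ?ip K a w0" for a K
        by (simp add: v_def sum_distrib_left sum_subtractf[symmetric] algebra_simps)
      have "?ip (insert y L) u' (\<lambda>x. f x - v x) = 0"
        unfolding split using v1(2)[OF u'] w0_orth[OF u'] by simp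
      moreover have "?ip (insert y L) w0 (\<lambda>x. f x - v x) = 0"
        unfolding split using w0_ne by (simp add: c_def)
      moreover have "?ip K u g = ?ip K u' g + cnj (u y) * ?ip K w0 g" for g K
        by (simp add: u'_def sum_distrib_left sum.distrib[symmetric] algebra_simps)
      ultimately show ?thesis by simp
    qed
    ultimately show ?thesis by blast
  qed
qed

section \<open>Polarisation of tensor powers\<close>

lemma sum_alternating_Pow:
  assumes "finite A"
  shows "(\<Sum>U\<in>Pow A. (- 1) ^ card U) = (if A = {} then 1 else 0 :: 'a :: comm_ring_1)"
  using assms
proof induction
  case (insert x A)
  have "(\<Sum>U\<in>insert x ` Pow A. (- 1) ^ card U) = (\<Sum>U\<in>Pow A. - ((- 1) ^ card U) :: 'a)"
  proof (subst sum.reindex)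
    show "inj_on (insert x) (Pow A)"
      using insert.hyps by (auto simp: inj_on_def)
    show "sum ((\<lambda>U. (- 1) ^ card U) \<circ> insert x) (Pow A) = (\<Sum>U\<in>Pow A. - ((- 1) ^ card U) :: 'a)"
    proof (rule sum.cong)
      fix U assume "U \<in> Pow A"
      then have "x \<notin> U" "finite U"
        using insert.hyps finite_subset by auto
      then show "((\<lambda>U. (- 1) ^ card U) \<circ> insert x) U = - ((- 1) ^ card U :: 'a)"
        by simp
    qed simp
  qed
  moreover have "Pow A \<inter> insert x ` Pow A = {}"
    using insert.hyps by auto
  ultimately show ?case
    using insert.hyps by (simp add: Pow_insert sum.union_disjoint sum_negf)
qed simp

text \<open>A surjective self-map of a finite set is bijective. The witnesses only translate between
  two conventions off \<open>S\<close>: elements of \<open>PiE\<close> are \<open>undefined\<close>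
  there, permutations are the identity.\<close>

lemma sum_functions_onto_eq_sum_permutations:
  assumes "finite S"
  shows "(\<Sum>f\<in>PiE S (\<lambda>_. S). if f ` S = S then F f else 0)
    = (\<Sum>\<pi> | \<pi> permutes S. F (restrict \<pi> S))"
proof -
  have "(\<Sum>f\<in>PiE S (\<lambda>_. S). if f ` S = S then F f else 0)
    = (\<Sum>f\<in>{f \<in> PiE S (\<lambda>_. S). f ` S = S}. F f)"
    using assms by (simp add: sum.If_cases Int_def finite_PiE)
  also have "\<dots> = (\<Sum>\<pi> | \<pi> permutes S. F (restrict \<pi> S))"
  proof (rule sum.reindex_bij_witness[of _ "\<lambda>\<pi>. restrict \<pi> S" "\<lambda>f x. if x \<in> S then f x else x"])
    fix f assume f: "f \<in> {f \<in> PiE S (\<lambda>_. S). f ` S = S}"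
    then show eq: "restrict (\<lambda>x. if x \<in> S then f x else x) S = f"
      by (fastforce simp: fun_eq_iff)
    have "bij_betw f S S"
      using f assms by (simp add: bij_betw_def finite_surj_inj)
    then have "bij_betw (\<lambda>x. if x \<in> S then f x else x) S S"
      by (rule iffD1[OF bij_betw_cong, rotated]) auto
    then show "(\<lambda>x. if x \<in> S then f x else x) \<in> {\<pi>. \<pi> permutes S}"
      by (auto intro: bij_imp_permutes)
    show "F (restrict (\<lambda>x. if x \<in> S then f x else x) S) = F f"
      by (simp only: eq)
  next
    fix \<pi> assume "\<pi> \<in> {\<pi>. \<pi> permutes S}"
    then have \<pi>: "\<pi> permutes S" by simp
    show "(\<lambda>x. if x \<in> S then restrict \<pi> S x else x) = \<pi>"
      using \<pi> by (auto simp: fun_eq_iff permutes_def)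
    show "restrict \<pi> S \<in> {f \<in> PiE S (\<lambda>_. S). f ` S = S}"
      using \<pi> by (auto simp: permutes_in_image permutes_image image_restrict_eq)
  qed
  finally show ?thesis .
qed

text \<open>Ryser's formula for the permanent; it polarises \<open>g \<mapsto> g\<^sup>\<otimes>\<^sup>d\<close>.\<close>

lemma permanent_eq_alternating_sum:
  fixes z :: "'s \<Rightarrow> 's \<Rightarrow> 'a :: comm_ring_1"
  assumes S: "finite S"
  shows "(\<Sum>U\<in>Pow S. (- 1) ^ card (S - U) * (\<Prod>t\<in>S. \<Sum>s\<in>U. z s t))
    = (\<Sum>\<pi> | \<pi> permutes S. \<Prod>t\<in>S. z (\<pi> t) t)"
proof -
  have fin: "finite (PiE S (\<lambda>_. S))" "finite (Pow S)"
    using S by (simp_all add: finite_PiE)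
  have "(\<Prod>t\<in>S. \<Sum>s\<in>U. z s t)
      = (\<Sum>f\<in>PiE S (\<lambda>_. S). if f ` S \<subseteq> U then \<Prod>t\<in>S. z (f t) t else 0)" if "U \<in> Pow S" for U
  proof -
    have "(\<Prod>t\<in>S. \<Sum>s\<in>U. z s t) = (\<Sum>f\<in>PiE S (\<lambda>_. U). \<Prod>t\<in>S. z (f t) t)"
      using S that finite_subset by (intro prod_sum_PiE) auto
    also have "PiE S (\<lambda>_. U) = {f \<in> PiE S (\<lambda>_. S). f ` S \<subseteq> U}"
      using that by (auto simp: PiE_iff extensional_def)
    finally show ?thesis
      using fin by (simp add: sum.If_cases Int_def)
  qed
  then have "(\<Sum>U\<in>Pow S. (- 1) ^ card (S - U) * (\<Prod>t\<in>S. \<Sum>s\<in>U. z s t))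
      = (\<Sum>U\<in>Pow S. \<Sum>f\<in>PiE S (\<lambda>_. S).
          if f ` S \<subseteq> U then (- 1) ^ card (S - U) * (\<Prod>t\<in>S. z (f t) t) else 0)"
    by (simp add: sum_distrib_left if_distrib[of "(*) _"] cong: if_cong)
  also have "\<dots> = (\<Sum>f\<in>PiE S (\<lambda>_. S). \<Sum>U\<in>Pow S.
          if f ` S \<subseteq> U then (- 1) ^ card (S - U) * (\<Prod>t\<in>S. z (f t) t) else 0)"
    by (rule sum.swap)
  \<comment> \<open>For fixed \<open>f\<close> the sets \<open>U\<close> run between the image of
    \<open>f\<close> and \<open>S\<close>; the alternating sum over their complements vanishes
    unless \<open>f\<close> is onto.\<close>
  also have "\<dots> = (\<Sum>f\<in>PiE S (\<lambda>_. S). if f ` S = S then \<Prod>t\<in>S. z (f t) t else 0)"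
  proof (rule sum.cong[OF refl])
    fix f assume "f \<in> PiE S (\<lambda>_. S)"
    then have f: "f ` S \<subseteq> S" by auto
    have "(\<Sum>U\<in>Pow S. if f ` S \<subseteq> U then (- 1) ^ card (S - U) * (\<Prod>t\<in>S. z (f t) t) else 0)
        = (\<Sum>U\<in>{U \<in> Pow S. f ` S \<subseteq> U}. (- 1) ^ card (S - U)) * (\<Prod>t\<in>S. z (f t) t)"
      using fin by (simp add: sum.If_cases Int_def sum_distrib_right)
    also have "(\<Sum>U\<in>{U \<in> Pow S. f ` S \<subseteq> U}. (- 1) ^ card (S - U) :: 'a)
        = (\<Sum>W\<in>Pow (S - f ` S). (- 1) ^ card W)"
      by (rule sum.reindex_bij_witness[of _ "\<lambda>W. S - W" "\<lambda>U. S - U"]) (use f in auto)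
    also have "\<dots> = (if S - f ` S = {} then 1 else 0)"
      using S by (intro sum_alternating_Pow) simp
    finally show "(\<Sum>U\<in>Pow S. if f ` S \<subseteq> U then (- 1) ^ card (S - U) * (\<Prod>t\<in>S. z (f t) t) else 0)
        = (if f ` S = S then \<Prod>t\<in>S. z (f t) t else 0)"
      using f by auto
  qed
  also have "\<dots> = (\<Sum>\<pi> | \<pi> permutes S. \<Prod>t\<in>S. z (restrict \<pi> S t) t)"
    by (rule sum_functions_onto_eq_sum_permutations[OF S])
  finally show ?thesis
    by simp
qed

text \<open>Matrices indexed by \<open>S \<rightarrow> 'n\<close> are the endomorphisms of \<open>V\<^sup>\<otimes>\<^sup>S\<close>.  The powers \<open>g\<^sup>\<otimes>\<^sup>S\<close> below come
  from applying Ryser's formula to matrix units.\<close>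

lemma invariant_kernel_eq_sum_tensor_powers:
  fixes A :: "('s \<Rightarrow> 'n::finite) \<Rightarrow> ('s \<Rightarrow> 'n) \<Rightarrow> complex"
  assumes S: "finite S"
    and inv: "\<And>\<pi> a c. \<pi> permutes S \<Longrightarrow> a \<in> PiE S (\<lambda>_. UNIV) \<Longrightarrow> c \<in> PiE S (\<lambda>_. UNIV) \<Longrightarrow>
      A (a \<circ> \<pi>) (c \<circ> \<pi>) = A a c"
  obtains Q :: "(('s \<Rightarrow> 'n) \<times> ('s \<Rightarrow> 'n) \<times> 's set) set" and \<kappa> and G :: "_ \<Rightarrow> complex ^ 'n ^ 'n"
  where "finite Q" "\<forall>a\<in>PiE S (\<lambda>_. UNIV). \<forall>c\<in>PiE S (\<lambda>_. UNIV).
    A a c = (\<Sum>x\<in>Q. \<kappa> x * (\<Prod>t\<in>S. G x $ a t $ c t))"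
proof
  let ?I = "PiE S (\<lambda>_. UNIV :: 'n set)"
  let ?E = "\<lambda>p q t u. if t = p \<and> u = q then 1 else 0 :: complex"
  \<comment> \<open>For fixed \<open>p\<close> and \<open>q\<close>, Ryser's formula for the matrix
    units at \<open>(p s, q s)\<close> yields the symmetrisation of their tensor product. Weighting
    with \<open>A p q\<close> and summing gives the average of \<open>A\<close> over all
    permutations, which is \<open>A\<close> by invariance; hence the denominator in
    \<open>\<kappa>\<close>.\<close>
  define G :: "('s \<Rightarrow> 'n) \<times> ('s \<Rightarrow> 'n) \<times> 's set \<Rightarrow> complex ^ 'n ^ 'n" where "G = (\<lambda>(p, q, U). \<chi> i j. \<Sum>s\<in>U. ?E (p s) (q s) i j)"
  define \<kappa> where "\<kappa> = (\<lambda>(p, q, U). A p q * (- 1) ^ card (S - U) / of_nat (card {\<pi>. \<pi> permutes S}))"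
  let ?Q = "?I \<times> ?I \<times> Pow S"
  have finI: "finite ?I" and finP: "finite {\<pi>. \<pi> permutes S}"
    using S by (simp_all add: finite_PiE finite_permutations)
  show "finite ?Q"
    using S finI by simp
  have card: "card {\<pi>. \<pi> permutes S} \<noteq> 0"
    using finP by (metis card_0_eq empty_iff mem_Collect_eq permutes_id)
  show "\<forall>a\<in>?I. \<forall>c\<in>?I. A a c = (\<Sum>x\<in>?Q. \<kappa> x * (\<Prod>t\<in>S. G x $ a t $ c t))"
  proof (intro ballI)
    fix a c assume a: "a \<in> ?I" and c: "c \<in> ?I"
    have "(\<Sum>x\<in>?Q. \<kappa> x * (\<Prod>t\<in>S. G x $ a t $ c t))
      = (\<Sum>p\<in>?I. \<Sum>q\<in>?I. A p q / of_nat (card {\<pi>. \<pi> permutes S}) *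
          (\<Sum>U\<in>Pow S. (- 1) ^ card (S - U) * (\<Prod>t\<in>S. \<Sum>s\<in>U. ?E (p s) (q s) (a t) (c t))))"
      by (simp add: sum.cartesian_product' \<kappa>_def G_def sum_distrib_left mult.assoc)
    also have "\<dots> = (\<Sum>p\<in>?I. \<Sum>q\<in>?I. A p q / of_nat (card {\<pi>. \<pi> permutes S}) *
          (\<Sum>\<pi> | \<pi> permutes S. \<Prod>t\<in>S. ?E (p (\<pi> t)) (q (\<pi> t)) (a t) (c t)))"
      by (simp only: permanent_eq_alternating_sum[OF S])
    also have "\<dots> = (\<Sum>p\<in>?I. \<Sum>q\<in>?I. \<Sum>\<pi> | \<pi> permutes S. A p q / of_nat (card {\<pi>. \<pi> permutes S}) *
          (if p = a \<circ> inv \<pi> \<and> q = c \<circ> inv \<pi> then 1 else 0))"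
    proof (intro sum.cong refl, subst sum_distrib_left, intro sum.cong refl)
      fix p q \<pi> assume p: "p \<in> ?I" and q: "q \<in> ?I" and "\<pi> \<in> {\<pi>. \<pi> permutes S}"
      then have \<pi>: "\<pi> permutes S" by simp
      \<comment> \<open>Off \<open>S\<close> the right-hand side holds because both functions are
        \<open>undefined\<close> there and \<open>inv \<pi>\<close> fixes every point.\<close>
      have eq: "(\<forall>t\<in>S. b t = r (\<pi> t)) \<longleftrightarrow> r = b \<circ> inv \<pi>" if "b \<in> ?I" "r \<in> ?I" for b r
      proof
        assume h: "\<forall>t\<in>S. b t = r (\<pi> t)"
        show "r = b \<circ> inv \<pi>"
        proof
          fix x show "r x = (b \<circ> inv \<pi>) x"
          proof (cases "x \<in> S")
            case True
            then have "inv \<pi> x \<in> S"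
              by (simp add: permutes_in_image[OF permutes_inv[OF \<pi>]])
            then show ?thesis using h by (simp add: permutes_inverses[OF \<pi>])
          next
            case False
            then have "inv \<pi> x = x"
              using permutes_inv[OF \<pi>] by (simp add: permutes_def)
            then show ?thesis using False that by (auto simp: PiE_iff extensional_def)
          qed
        qed
      next
        assume "r = b \<circ> inv \<pi>"
        then show "\<forall>t\<in>S. b t = r (\<pi> t)"
          by (simp add: permutes_inverses[OF \<pi>])
      qed
      have "(\<Prod>t\<in>S. ?E (p (\<pi> t)) (q (\<pi> t)) (a t) (c t))
        = (if (\<forall>t\<in>S. a t = p (\<pi> t)) \<and> (\<forall>t\<in>S. c t = q (\<pi> t)) then 1 else 0)"
        using S by auto
      then show "A p q / of_nat (card {\<pi>. \<pi> permutes S}) *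
          (\<Prod>t\<in>S. ?E (p (\<pi> t)) (q (\<pi> t)) (a t) (c t))
        = A p q / of_nat (card {\<pi>. \<pi> permutes S}) *
          (if p = a \<circ> inv \<pi> \<and> q = c \<circ> inv \<pi> then 1 else 0)"
        by (simp only: eq[OF a p] eq[OF c q])
    qed
    also have "\<dots> = (\<Sum>\<pi> | \<pi> permutes S. \<Sum>p\<in>?I. \<Sum>q\<in>?I. A p q / of_nat (card {\<pi>. \<pi> permutes S}) *
          (if p = a \<circ> inv \<pi> \<and> q = c \<circ> inv \<pi> then 1 else 0))"
      by (subst sum.swap[of _ "{\<pi>. \<pi> permutes S}" ?I], subst sum.swap[of _ "{\<pi>. \<pi> permutes S}" ?I]) simp
    also have "\<dots> = (\<Sum>\<pi> | \<pi> permutes S. A a c / of_nat (card {\<pi>. \<pi> permutes S}))"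
    proof (intro sum.cong refl)
      fix \<pi> assume "\<pi> \<in> {\<pi>. \<pi> permutes S}"
      then have \<pi>: "inv \<pi> permutes S" by (simp add: permutes_inv)
      have mem: "b \<circ> inv \<pi> \<in> ?I" if "b \<in> ?I" for b
        using that \<pi> by (auto simp: PiE_iff extensional_def permutes_def)
      have "(\<Sum>p\<in>?I. \<Sum>q\<in>?I. A p q / of_nat (card {\<pi>. \<pi> permutes S}) *
          (if p = a \<circ> inv \<pi> \<and> q = c \<circ> inv \<pi> then 1 else 0))
        = (\<Sum>p\<in>?I. if p = a \<circ> inv \<pi> then \<Sum>q\<in>?I. if q = c \<circ> inv \<pi>
            then A p q / of_nat (card {\<pi>. \<pi> permutes S}) else 0 else 0)"
        by (intro sum.cong refl) (auto intro!: sum.cong)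
      also have "\<dots> = A (a \<circ> inv \<pi>) (c \<circ> inv \<pi>) / of_nat (card {\<pi>. \<pi> permutes S})"
        using finI mem[OF a] mem[OF c] by simp
      finally show "(\<Sum>p\<in>?I. \<Sum>q\<in>?I. A p q / of_nat (card {\<pi>. \<pi> permutes S}) *
          (if p = a \<circ> inv \<pi> \<and> q = c \<circ> inv \<pi> then 1 else 0))
        = A a c / of_nat (card {\<pi>. \<pi> permutes S})"
        by (simp only: inv[OF \<pi> a c])
    qed
    also have "\<dots> = A a c"
      using card by simp
    finally show "A a c = (\<Sum>x\<in>?Q. \<kappa> x * (\<Prod>t\<in>S. G x $ a t $ c t))"
      by simp
  qed
qed

section \<open>From invertible matrices to all matrices\<close>

lemma poly_eq_0_if_cofinite_roots:
  fixes p :: "'a :: {idom, ring_char_0} poly"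
  assumes "finite {x. poly p x \<noteq> 0}"
  shows "p = 0"
proof (rule ccontr)
  assume "p \<noteq> 0"
  then have "finite {x. poly p x = 0}" by (rule poly_roots_finite)
  with assms have "finite ({x. poly p x \<noteq> 0} \<union> {x. poly p x = 0})" by simp
  moreover have "{x. poly p x \<noteq> 0} \<union> {x. poly p x = 0} = UNIV" by auto
  ultimately show False
    by (simp add: infinite_UNIV_char_0)
qed

text \<open>Instead of the characteristic polynomial, its reversal \<open>q\<close>, the determinant
  of \<open>1 + x g\<close> as a polynomial in \<open>x\<close>, is used: \<open>q\<close> is 1 at
  0, so it is nonzero without any knowledge of a leading coefficient. A nonzero bad \<epsilon> gives
  the root \<open>inverse \<epsilon>\<close> of \<open>q\<close>.\<close>

lemma finite_not_invertible_scalar_add: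
  fixes g :: "complex ^ 'n ^ 'n"
  shows "finite {\<epsilon>. \<not> invertible (\<chi> i j. (if i = j then \<epsilon> else 0) + g $ i $ j)}"
proof -
  define q where "q = (\<Sum>p | p permutes (UNIV :: 'n set).
    of_int (sign p) * (\<Prod>i\<in>UNIV. [:if i = p i then 1 else 0, g $ i $ p i:]))"
  have q: "poly q x = det (\<chi> i j. (if i = j then 1 else 0) + x * g $ i $ j)" for x
    by (simp add: q_def det_def poly_sum poly_prod)
  have "poly q 0 = det (mat 1 :: complex ^ 'n ^ 'n)"
    unfolding q by (rule arg_cong[of _ _ det]) (simp add: mat_def vec_eq_iff)
  then have "q \<noteq> 0" by auto
  then have "finite {x. poly q x = 0}" by (rule poly_roots_finite)
  then have "finite (insert 0 (inverse ` {x. poly q x = 0}))" by simp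
  moreover have "{\<epsilon>. \<not> invertible (\<chi> i j. (if i = j then \<epsilon> else 0) + g $ i $ j)}
    \<subseteq> insert 0 (inverse ` {x. poly q x = 0})"
  proof
    fix \<epsilon> assume e: "\<epsilon> \<in> {\<epsilon>. \<not> invertible (\<chi> i j. (if i = j then \<epsilon> else 0) + g $ i $ j)}"
    show "\<epsilon> \<in> insert 0 (inverse ` {x. poly q x = 0})"
    proof (cases "\<epsilon> = 0")
      case False
      let ?a = "\<lambda>i. \<chi> j. (if i = j then 1 else 0) + inverse \<epsilon> * g $ i $ j"
      have "(\<chi> i j. (if i = j then \<epsilon> else 0) + g $ i $ j) = (\<chi> i. \<epsilon> *s ?a i)"
        using False by (auto simp: vec_eq_iff distrib_left)
      then have "det (\<chi> i j. (if i = j then \<epsilon> else 0) + g $ i $ j)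
          = (\<Prod>i\<in>(UNIV :: 'n set). \<epsilon>) * poly q (inverse \<epsilon>)"
        unfolding q by (simp only: det_rows_mul)
      moreover have "det (\<chi> i j. (if i = j then \<epsilon> else 0) + g $ i $ j) = 0"
        using e by (simp add: invertible_det_nz)
      ultimately have "poly q (inverse \<epsilon>) = 0"
        using False by simp
      then show ?thesis by (intro insertI2 image_eqI[of _ _ "inverse \<epsilon>"]) simp_all
    qed simp
  qed
  ultimately show ?thesis
    by (rule finite_subset[rotated])
qed

text \<open>Along the line \<epsilon> + g the difference of both sides is a polynomial in
  \<epsilon>. It vanishes wherever the matrix is invertible, so for all but finitely many
  \<epsilon>, and therefore also at \<epsilon> = 0.\<close>

lemma commutes_tensor_powers_if_invertible:
  fixes T :: "('s \<Rightarrow> 'n::finite) \<Rightarrow> ('s \<Rightarrow> 'n) \<Rightarrow> complex" and S :: "'s set"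
  defines "I \<equiv> PiE S (\<lambda>_. UNIV)"
  assumes comm: "\<And>g :: complex ^ 'n ^ 'n. invertible g \<Longrightarrow>
    (\<Sum>b\<in>I. T a b * (\<Prod>s\<in>S. g $ b s $ c s)) = (\<Sum>b\<in>I. (\<Prod>s\<in>S. g $ a s $ b s) * T b c)"
  shows "(\<Sum>b\<in>I. T a b * (\<Prod>s\<in>S. g $ b s $ c s)) = (\<Sum>b\<in>I. (\<Prod>s\<in>S. g $ a s $ b s) * T b c)"
proof -
  let ?l = "\<lambda>i j. [:g $ i $ j, if i = j then 1 else 0:]"
  define P where "P = (\<Sum>b\<in>I. [:T a b:] * (\<Prod>s\<in>S. ?l (b s) (c s)))
    - (\<Sum>b\<in>I. (\<Prod>s\<in>S. ?l (a s) (b s)) * [:T b c:])"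
  let ?g = "\<lambda>\<epsilon>. \<chi> i j. (if i = j then \<epsilon> else 0) + g $ i $ j"
  have l: "poly (?l i j) \<epsilon> = ?g \<epsilon> $ i $ j" for i j \<epsilon>
    by simp
  have P: "poly P \<epsilon> = (\<Sum>b\<in>I. T a b * (\<Prod>s\<in>S. ?g \<epsilon> $ b s $ c s))
    - (\<Sum>b\<in>I. (\<Prod>s\<in>S. ?g \<epsilon> $ a s $ b s) * T b c)" for \<epsilon>
    unfolding P_def poly_diff poly_sum poly_mult poly_prod l by simp
  have "{\<epsilon>. poly P \<epsilon> \<noteq> 0} \<subseteq> {\<epsilon>. \<not> invertible (?g \<epsilon>)}"
  proof (rule subsetI, rule ccontr)
    fix \<epsilon> assume "\<epsilon> \<in> {\<epsilon>. poly P \<epsilon> \<noteq> 0}" "\<epsilon> \<notin> {\<epsilon>. \<not> invertible (?g \<epsilon>)}"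
    then show False
      using comm[of "?g \<epsilon>"] unfolding P by simp
  qed
  then have "finite {\<epsilon>. poly P \<epsilon> \<noteq> 0}"
    using finite_not_invertible_scalar_add[of g] by (rule finite_subset)
  then have "P = 0" by (rule poly_eq_0_if_cofinite_roots)
  then have "poly P 0 = 0" by simp
  then show ?thesis by (simp add: P cong: if_cong)
qed

section \<open>The span of the permutation operators and its bicommutant\<close>

lemma finite_power_indices: "finite S \<Longrightarrow> finite (PiE S (\<lambda>_. UNIV :: 'n::finite set))"
  by (simp add: finite_PiE)

lemma comp_permutes_in_PiE:
  assumes "\<pi> permutes S" "a \<in> PiE S (\<lambda>_. B)"
  shows "a \<circ> \<pi> \<in> PiE S (\<lambda>_. B)"
proof (rule PiE_I)
  fix x assume "x \<in> S"
  then show "(a \<circ> \<pi>) x \<in> B"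
    using assms(2) permutes_in_image[OF assms(1), of x] by (auto simp: PiE_iff)
next
  fix x assume "x \<notin> S"
  then show "(a \<circ> \<pi>) x = undefined"
    using assms(2) permutes_not_in[OF assms(1)] by (auto simp: PiE_iff extensional_def)
qed

lemma sum_comp_permutes:
  assumes "\<pi> permutes S"
  shows "(\<Sum>a\<in>PiE S (\<lambda>_. B). f (a \<circ> \<pi>)) = (\<Sum>a\<in>PiE S (\<lambda>_. B). f a)"
proof (rule sum.reindex_bij_witness[of _ "\<lambda>a. a \<circ> inv \<pi>" "\<lambda>a. a \<circ> \<pi>"])
  fix a assume a: "a \<in> PiE S (\<lambda>_. B)"
  show "a \<circ> \<pi> \<circ> inv \<pi> = a" "a \<circ> inv \<pi> \<circ> \<pi> = a"
    by (simp_all add: comp_assoc permutes_inv_o[OF assms])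
  show "a \<circ> \<pi> \<in> PiE S (\<lambda>_. B)" "a \<circ> inv \<pi> \<in> PiE S (\<lambda>_. B)"
    using a by (rule comp_permutes_in_PiE[OF assms] comp_permutes_in_PiE[OF permutes_inv[OF assms]])+
qed (rule refl)

text \<open>The image of the group algebra of the permutations of \<open>S\<close> in the
  endomorphisms of the tensor power. A kernel is a function of a pair, so that it is itself a vector
  to which orthogonal projection applies; its values off the index set are unconstrained.\<close>

definition permutation_operators :: "'s set \<Rightarrow> (('s \<Rightarrow> 'n) \<times> ('s \<Rightarrow> 'n) \<Rightarrow> complex) set"
  where "permutation_operators S = {M. \<exists>\<gamma>. \<forall>a\<in>PiE S (\<lambda>_. UNIV). \<forall>b\<in>PiE S (\<lambda>_. UNIV).
    M (a, b) = (\<Sum>\<pi> | \<pi> permutes S. \<gamma> \<pi> * (if b = a \<circ> \<pi> then 1 else 0))}"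

lemma permutation_operators_cong:
  assumes "u \<in> permutation_operators S"
    and "\<And>a b. a \<in> PiE S (\<lambda>_. UNIV) \<Longrightarrow> b \<in> PiE S (\<lambda>_. UNIV) \<Longrightarrow> v (a, b) = u (a, b)"
  shows "v \<in> permutation_operators S"
  using assms by (simp add: permutation_operators_def)

lemma permutation_operators_zero: "(\<lambda>_. 0) \<in> permutation_operators S"
  by (auto simp: permutation_operators_def intro: exI[of _ "\<lambda>_. 0"])

lemma permutation_operators_add:
  assumes "u \<in> permutation_operators S" "v \<in> permutation_operators S"
  shows "(\<lambda>x. u x + v x) \<in> permutation_operators S"
proof -
  obtain \<gamma> \<delta> where "\<forall>a\<in>PiE S (\<lambda>_. UNIV). \<forall>b\<in>PiE S (\<lambda>_. UNIV).
      u (a, b) = (\<Sum>\<pi> | \<pi> permutes S. \<gamma> \<pi> * (if b = a \<circ> \<pi> then 1 else 0))"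
    "\<forall>a\<in>PiE S (\<lambda>_. UNIV). \<forall>b\<in>PiE S (\<lambda>_. UNIV).
      v (a, b) = (\<Sum>\<pi> | \<pi> permutes S. \<delta> \<pi> * (if b = a \<circ> \<pi> then 1 else 0))"
    using assms unfolding permutation_operators_def by blast
  then show ?thesis
    unfolding permutation_operators_def
    by (auto intro!: exI[of _ "\<lambda>\<pi>. \<gamma> \<pi> + \<delta> \<pi>"] simp: distrib_right sum.distrib)
qed

lemma permutation_operators_scale:
  assumes "u \<in> permutation_operators S"
  shows "(\<lambda>x. c * u x) \<in> permutation_operators S"
proof -
  obtain \<gamma> where "\<forall>a\<in>PiE S (\<lambda>_. UNIV). \<forall>b\<in>PiE S (\<lambda>_. UNIV).
      u (a, b) = (\<Sum>\<pi> | \<pi> permutes S. \<gamma> \<pi> * (if b = a \<circ> \<pi> then 1 else 0))"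
    using assms unfolding permutation_operators_def by blast
  then show ?thesis
    unfolding permutation_operators_def
    by (auto intro!: exI[of _ "\<lambda>\<pi>. c * \<gamma> \<pi>"] simp: sum_distrib_left mult.assoc)
qed

lemma permutation_operators_sum:
  "(\<And>i. i \<in> A \<Longrightarrow> u i \<in> permutation_operators S) \<Longrightarrow> (\<lambda>x. \<Sum>i\<in>A. u i x) \<in> permutation_operators S"
  by (induction A rule: infinite_finite_induct)
    (auto simp: permutation_operators_zero intro!: permutation_operators_add)

lemma permutation_operators_identity:
  assumes "finite S"
  shows "(\<lambda>x. if fst x = snd x then 1 else 0) \<in> permutation_operators S"
proof -
  have "(\<Sum>\<pi> | \<pi> permutes S. (if \<pi> = id then 1 else 0) * (if b = a \<circ> \<pi> then 1 else 0))
      = (if a = b then 1 else 0 :: complex)" for a b :: "'a \<Rightarrow> 'b"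
  proof -
    have "(\<Sum>\<pi> | \<pi> permutes S. (if \<pi> = id then 1 else 0) * (if b = a \<circ> \<pi> then 1 else 0))
      = (\<Sum>\<pi> | \<pi> permutes S. if \<pi> = id then (if b = a then 1 else 0) else 0 :: complex)"
      by (intro sum.cong) auto
    then show ?thesis
      using assms by (simp add: finite_permutations permutes_id)
  qed
  then show ?thesis
    unfolding permutation_operators_def by (auto intro!: exI[of _ "\<lambda>\<pi>. if \<pi> = id then 1 else 0"])
qed

text \<open>Left multiplication by a permutation operator shifts the coefficients along \<pi>
  \<mapsto> \<sigma> \<circ> \<pi>, so the span is a left module.\<close>

lemma permutation_operators_left_mult:
  assumes "M \<in> permutation_operators S" and \<sigma>: "\<sigma> permutes S"
  shows "(\<lambda>x. M (fst x \<circ> \<sigma>, snd x)) \<in> permutation_operators S"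
proof -
  obtain \<gamma> where \<gamma>: "\<And>a b. a \<in> PiE S (\<lambda>_. UNIV) \<Longrightarrow> b \<in> PiE S (\<lambda>_. UNIV) \<Longrightarrow>
      M (a, b) = (\<Sum>\<pi> | \<pi> permutes S. \<gamma> \<pi> * (if b = a \<circ> \<pi> then 1 else 0))"
    using assms(1) unfolding permutation_operators_def by blast
  have "(\<Sum>\<pi> | \<pi> permutes S. \<gamma> \<pi> * (if b = a \<circ> \<sigma> \<circ> \<pi> then 1 else 0))
    = (\<Sum>\<pi> | \<pi> permutes S. \<gamma> (inv \<sigma> \<circ> \<pi>) * (if b = a \<circ> \<pi> then 1 else 0))" for a b :: "'a \<Rightarrow> 'b"
    by (subst (2) setum_permutations_compose_left[OF \<sigma>])
      (simp add: o_assoc permutes_inv_o[OF \<sigma>])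
  then show ?thesis
    unfolding permutation_operators_def
    by (auto intro!: exI[of _ "\<lambda>\<pi>. \<gamma> (inv \<sigma> \<circ> \<pi>)"] simp: \<gamma> comp_permutes_in_PiE[OF \<sigma>])
qed

text \<open>The difference of two projections lies in \<open>V\<close> and is orthogonal to
  \<open>V\<close>, hence to itself. Only the values on \<open>L\<close> are determined.\<close>

lemma orthogonal_projection_unique:
  fixes V :: "('x \<Rightarrow> complex) set"
  assumes L: "finite L" "x \<in> L"
    and V: "\<And>u v. u \<in> V \<Longrightarrow> v \<in> V \<Longrightarrow> (\<lambda>x. u x + v x) \<in> V"
      "\<And>c u. u \<in> V \<Longrightarrow> (\<lambda>x. c * u x) \<in> V"
    and v: "v \<in> V" "\<And>u. u \<in> V \<Longrightarrow> (\<Sum>x\<in>L. cnj (u x) * (f x - v x)) = 0"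
    and v': "v' \<in> V" "\<And>u. u \<in> V \<Longrightarrow> (\<Sum>x\<in>L. cnj (u x) * (f x - v' x)) = 0"
  shows "v x = v' x"
proof -
  define u where "u = (\<lambda>x. v x + (- 1) * v' x)"
  have u: "u \<in> V"
    unfolding u_def by (intro V v v')
  have "(\<Sum>x\<in>L. cnj (u x) * u x) = (\<Sum>x\<in>L. cnj (u x) * (f x - v' x)) - (\<Sum>x\<in>L. cnj (u x) * (f x - v x))"
    unfolding sum_subtractf[symmetric] by (intro sum.cong refl) (simp add: u_def algebra_simps)
  also have "\<dots> = 0"
    using u v(2) v'(2) by simp
  finally have "u x = 0"
    by (rule sum_cnj_mult_self_eq_0[OF L(1) _ L(2)])
  then show ?thesis by (simp add: u_def)
qed

text \<open>
  The argument of the bicommutant theorem: the orthogonal projection \<open>p\<close> of all matrices onto the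
  span of the permutation operators is given by matrices \<open>A b e\<close> in the commutant, so
  \<open>T = T p(1) = p(T)\<close>.
\<close>

lemma commutant_of_invariants_is_permutation_operator:
  fixes T :: "('s \<Rightarrow> 'n::finite) \<Rightarrow> ('s \<Rightarrow> 'n) \<Rightarrow> complex" and S :: "'s set"
  defines "I \<equiv> PiE S (\<lambda>_. UNIV)"
  assumes S: "finite S"
    and comm: "\<And>A a c. (\<And>\<pi> a c. \<pi> permutes S \<Longrightarrow> a \<in> I \<Longrightarrow> c \<in> I \<Longrightarrow> A (a \<circ> \<pi>) (c \<circ> \<pi>) = A a c) \<Longrightarrow>
      a \<in> I \<Longrightarrow> c \<in> I \<Longrightarrow> (\<Sum>b\<in>I. T a b * A b c) = (\<Sum>b\<in>I. A a b * T b c)"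
  shows "(\<lambda>x. T (fst x) (snd x)) \<in> permutation_operators S"
proof -
  let ?B = "permutation_operators S :: (('s \<Rightarrow> 'n) \<times> ('s \<Rightarrow> 'n) \<Rightarrow> complex) set"
  let ?L = "I \<times> I"
  let ?orth = "\<lambda>f v. \<forall>u\<in>?B. (\<Sum>x\<in>?L. cnj (u x) * (f x - v x)) = 0"
  let ?\<delta> = "\<lambda>c e x. if x = (c, e) then 1 else 0 :: complex"
  have finI: "finite I" and finL: "finite ?L"
    using S by (simp_all add: I_def finite_power_indices)
  have ex: "\<exists>v. v \<in> ?B \<and> ?orth f v" for f
  proof -
    have "\<exists>v\<in>?B. ?orth f v"
      by (rule orthogonal_projection_exists[OF finL])
        (simp_all add: permutation_operators_zero permutation_operators_add permutation_operators_scale)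
    then show ?thesis by (rule bexE) (intro exI conjI)
  qed
  have "\<exists>p. \<forall>c e. p c e \<in> ?B \<and> ?orth (?\<delta> c e) (p c e)"
    by (intro choice allI ex)
  then obtain p where "\<forall>c e. p c e \<in> ?B \<and> ?orth (?\<delta> c e) (p c e)"
    by (rule exE)
  then have p: "p c e \<in> ?B" "?orth (?\<delta> c e) (p c e)" for c e
    by simp_all
  note unique = orthogonal_projection_unique[where V = ?B, OF finL _ permutation_operators_add
      permutation_operators_scale]
  \<comment> \<open>The diagonal matrix units add up to the identity, which already lies in the span
    and is thus its own projection.\<close>
  have one: "(\<Sum>e\<in>I. p e e (a, b)) = (if a = b then 1 else 0)" if "a \<in> I" "b \<in> I" for a b
  proof -
    have delta: "(\<Sum>e\<in>I. ?\<delta> e e x) = (if fst x = snd x then 1 else 0)" if "x \<in> ?L" for x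
    proof -
      have "(\<Sum>e\<in>I. ?\<delta> e e x) = (\<Sum>e\<in>I. if e = fst x then if fst x = snd x then 1 else 0 else 0)"
        by (intro sum.cong) (auto simp: prod_eq_iff)
      then show ?thesis using that finI by (auto simp: mem_Times_iff)
    qed
    have "(\<lambda>x. \<Sum>e\<in>I. p e e x) (a, b) = (\<lambda>x. if fst x = snd x then 1 else 0) (a, b)"
    proof (rule unique[where x = "(a, b)" and f = "\<lambda>x. \<Sum>e\<in>I. ?\<delta> e e x"
          and v = "\<lambda>x. \<Sum>e\<in>I. p e e x" and v' = "\<lambda>x. if fst x = snd x then 1 else 0"])
      show "(a, b) \<in> ?L" using that by simp
      show "(\<lambda>x. \<Sum>e\<in>I. p e e x) \<in> ?B"
        by (intro permutation_operators_sum p)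
      show "(\<lambda>x. if fst x = snd x then 1 else 0) \<in> ?B"
        by (rule permutation_operators_identity[OF S])
      fix u assume u: "u \<in> ?B"
      have "(\<Sum>x\<in>?L. cnj (u x) * ((\<Sum>e\<in>I. ?\<delta> e e x) - (\<Sum>e\<in>I. p e e x)))
        = (\<Sum>x\<in>?L. \<Sum>e\<in>I. cnj (u x) * (?\<delta> e e x - p e e x))"
        by (simp only: sum_subtractf[symmetric] sum_distrib_left)
      also have "\<dots> = (\<Sum>e\<in>I. \<Sum>x\<in>?L. cnj (u x) * (?\<delta> e e x - p e e x))"
        by (rule sum.swap)
      also have "\<dots> = 0"
        using p(2) u by (intro sum.neutral) blast
      finally show "(\<Sum>x\<in>?L. cnj (u x) * ((\<Sum>e\<in>I. ?\<delta> e e x) - (\<Sum>e\<in>I. p e e x))) = 0" .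
      show "(\<Sum>x\<in>?L. cnj (u x) * ((\<Sum>e\<in>I. ?\<delta> e e x) - (if fst x = snd x then 1 else 0))) = 0"
      proof (rule sum.neutral, rule ballI)
        fix x assume "x \<in> ?L"
        then show "cnj (u x) * ((\<Sum>e\<in>I. ?\<delta> e e x) - (if fst x = snd x then 1 else 0)) = 0"
          by (simp only: delta diff_self mult_zero_right)
      qed
    qed
    then show ?thesis by simp
  qed
  \<comment> \<open>Left multiplication by a permutation operator is unitary and preserves the span,
    so it commutes with the projection. Read as a statement on the kernel
    \<open>\<lambda>x y. p y e (x, b)\<close>, this is the invariance that \<open>comm\<close> asks
    for.\<close>
  have equivariant: "p (c \<circ> \<pi>) e (a \<circ> \<pi>, b) = p c e (a, b)"
    if \<pi>: "\<pi> permutes S" and mem: "a \<in> I" "b \<in> I" "c \<in> I" for \<pi> a b c e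
  proof -
    have "(\<lambda>x. p (c \<circ> \<pi>) e (fst x \<circ> \<pi>, snd x)) (a, b) = p c e (a, b)"
    proof (rule unique[where x = "(a, b)" and f = "?\<delta> c e"
          and v = "\<lambda>x. p (c \<circ> \<pi>) e (fst x \<circ> \<pi>, snd x)" and v' = "p c e"])
      show "(a, b) \<in> ?L" using mem by simp
      show "(\<lambda>x. p (c \<circ> \<pi>) e (fst x \<circ> \<pi>, snd x)) \<in> ?B"
        by (rule permutation_operators_left_mult[OF p(1) \<pi>])
      show "p c e \<in> ?B" by (rule p)
      show "(\<Sum>x\<in>?L. cnj (u x) * (?\<delta> c e x - p c e x)) = 0" if "u \<in> ?B" for u
        using p(2) that by blast
      fix u assume "u \<in> ?B"
      then have u: "(\<lambda>x. u (fst x \<circ> inv \<pi>, snd x)) \<in> ?B"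
        by (rule permutation_operators_left_mult) (rule permutes_inv[OF \<pi>])
      have cancel: "x \<circ> \<pi> \<circ> inv \<pi> = x" for x :: "'s \<Rightarrow> 'n"
        by (simp add: comp_assoc permutes_inv_o[OF \<pi>])
      then have inj: "x \<circ> \<pi> = y \<circ> \<pi> \<longleftrightarrow> x = y" for x y :: "'s \<Rightarrow> 'n"
        by metis
      have "(\<Sum>x\<in>?L. cnj (u x) * (?\<delta> c e x - p (c \<circ> \<pi>) e (fst x \<circ> \<pi>, snd x)))
        = (\<Sum>x\<in>I. \<Sum>y\<in>I. cnj (u (x \<circ> \<pi> \<circ> inv \<pi>, y)) * (?\<delta> (c \<circ> \<pi>) e (x \<circ> \<pi>, y) - p (c \<circ> \<pi>) e (x \<circ> \<pi>, y)))"
        by (simp add: sum.cartesian_product' cancel inj cong: if_cong)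
      also have "\<dots> = (\<Sum>x\<in>I. \<Sum>y\<in>I. cnj (u (x \<circ> inv \<pi>, y)) * (?\<delta> (c \<circ> \<pi>) e (x, y) - p (c \<circ> \<pi>) e (x, y)))"
        unfolding I_def by (rule sum_comp_permutes[OF \<pi>])
      also have "\<dots> = (\<Sum>x\<in>?L. cnj (u (fst x \<circ> inv \<pi>, snd x)) * (?\<delta> (c \<circ> \<pi>) e x - p (c \<circ> \<pi>) e x))"
        by (simp add: sum.cartesian_product')
      also have "\<dots> = 0"
        by (rule bspec[OF p(2) u])
      finally show "(\<Sum>x\<in>?L. cnj (u x) * (?\<delta> c e x - p (c \<circ> \<pi>) e (fst x \<circ> \<pi>, snd x))) = 0" .
    qed
    then show ?thesis by simp
  qed
  \<comment> \<open>\<open>T\<close> is multiplied by the projection of the identity and moved to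
    the other side of each kernel by \<open>comm\<close>. What remains is a combination of
    projections \<open>p y e\<close>, with the entries of \<open>T\<close> as coefficients.\<close>
  have T: "T a b = (\<Sum>e\<in>I. \<Sum>y\<in>I. T y e * p y e (a, b))" if ab: "a \<in> I" "b \<in> I" for a b
  proof -
    have "T a b = (\<Sum>x\<in>I. T a x * (\<Sum>e\<in>I. p e e (x, b)))"
      using ab finI by (simp add: one if_distrib[of "(*) _"] cong: if_cong)
    also have "\<dots> = (\<Sum>x\<in>I. \<Sum>e\<in>I. T a x * p e e (x, b))"
      by (simp add: sum_distrib_left)
    also have "\<dots> = (\<Sum>e\<in>I. \<Sum>x\<in>I. T a x * p e e (x, b))"
      by (rule sum.swap)
    also have "\<dots> = (\<Sum>e\<in>I. \<Sum>y\<in>I. p y e (a, b) * T y e)"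
      by (intro sum.cong refl comm[of "\<lambda>x y. p y _ (x, b)"]) (use equivariant ab in auto)
    finally show ?thesis by (simp add: mult.commute)
  qed
  have "(\<lambda>x. \<Sum>e\<in>I. \<Sum>y\<in>I. T y e * p y e x) \<in> ?B"
    by (intro permutation_operators_sum permutation_operators_scale p)
  then show ?thesis
    by (rule permutation_operators_cong) (simp only: fst_conv snd_conv T[unfolded I_def] I_def)
qed

text \<open>Commutation passes from invertible \<open>g\<close> to all matrices, then to linear
  combinations of tensor powers. By polarisation these include every kernel invariant under
  permutations, and the bicommutant argument applies.\<close>

theorem commutes_with_GL_imp_permutation_operator:
  fixes T :: "('s \<Rightarrow> 'n::finite) \<Rightarrow> ('s \<Rightarrow> 'n) \<Rightarrow> complex" and S :: "'s set"
  defines "I \<equiv> PiE S (\<lambda>_. UNIV)"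
  assumes S: "finite S"
    and comm: "\<And>(g :: complex ^ 'n ^ 'n) a c. invertible g \<Longrightarrow> a \<in> I \<Longrightarrow> c \<in> I \<Longrightarrow>
      (\<Sum>b\<in>I. T a b * (\<Prod>s\<in>S. g $ b s $ c s)) = (\<Sum>b\<in>I. (\<Prod>s\<in>S. g $ a s $ b s) * T b c)"
  shows "\<exists>\<gamma>. \<forall>a\<in>I. \<forall>b\<in>I.
    T a b = (\<Sum>\<pi> | \<pi> permutes S. \<gamma> \<pi> * (if b = a \<circ> \<pi> then 1 else 0))"
proof -
  have comm': "(\<Sum>b\<in>I. T a b * (\<Prod>s\<in>S. g $ b s $ c s)) = (\<Sum>b\<in>I. (\<Prod>s\<in>S. g $ a s $ b s) * T b c)"
    if "a \<in> I" "c \<in> I" for g :: "complex ^ 'n ^ 'n" and a c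
    using comm[OF _ that] unfolding I_def by (rule commutes_tensor_powers_if_invertible)
  have "(\<lambda>x. T (fst x) (snd x)) \<in> permutation_operators S"
  proof (rule commutant_of_invariants_is_permutation_operator[OF S, where T = T, folded I_def])
    fix A :: "('s \<Rightarrow> 'n) \<Rightarrow> ('s \<Rightarrow> 'n) \<Rightarrow> complex" and a c
    assume A: "\<And>\<pi> a c. \<pi> permutes S \<Longrightarrow> a \<in> I \<Longrightarrow> c \<in> I \<Longrightarrow> A (a \<circ> \<pi>) (c \<circ> \<pi>) = A a c"
      and mem: "a \<in> I" "c \<in> I"
    obtain Q :: "(('s \<Rightarrow> 'n) \<times> ('s \<Rightarrow> 'n) \<times> 's set) set" and \<kappa> and G :: "_ \<Rightarrow> complex ^ 'n ^ 'n"
      where "finite Q"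
        and "\<forall>a\<in>I. \<forall>c\<in>I. A a c = (\<Sum>x\<in>Q. \<kappa> x * (\<Prod>t\<in>S. G x $ a t $ c t))"
      by (rule invariant_kernel_eq_sum_tensor_powers[OF S, of A, folded I_def, OF A])
    then have eq: "A a c = (\<Sum>x\<in>Q. \<kappa> x * (\<Prod>t\<in>S. G x $ a t $ c t))"
      if "a \<in> I" "c \<in> I" for a c
      using that by blast
    have "(\<Sum>b\<in>I. T a b * A b c) = (\<Sum>b\<in>I. \<Sum>x\<in>Q. \<kappa> x * (T a b * (\<Prod>t\<in>S. G x $ b t $ c t)))"
      using mem by (intro sum.cong refl) (simp add: eq sum_distrib_left mult.left_commute)
    also have "\<dots> = (\<Sum>x\<in>Q. \<kappa> x * (\<Sum>b\<in>I. T a b * (\<Prod>t\<in>S. G x $ b t $ c t)))"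
      by (subst sum.swap) (simp add: sum_distrib_left)
    also have "\<dots> = (\<Sum>x\<in>Q. \<kappa> x * (\<Sum>b\<in>I. (\<Prod>t\<in>S. G x $ a t $ b t) * T b c))"
      by (simp only: comm'[OF mem])
    also have "\<dots> = (\<Sum>b\<in>I. \<Sum>x\<in>Q. \<kappa> x * ((\<Prod>t\<in>S. G x $ a t $ b t) * T b c))"
      by (subst sum.swap) (simp add: sum_distrib_left)
    also have "\<dots> = (\<Sum>b\<in>I. A a b * T b c)"
      using mem by (intro sum.cong refl) (simp add: eq sum_distrib_right mult.assoc)
    finally show "(\<Sum>b\<in>I. T a b * A b c) = (\<Sum>b\<in>I. A a b * T b c)" .
  qed
  then show ?thesis
    unfolding permutation_operators_def I_def by simp
qed

section \<open>Tensors representing polynomials\<close>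

text \<open>An element of \<open>tensor_indices D\<close> is a length \<open>d \<le> D\<close> together with a word of that length, so
  that functions on it are elements of the truncated tensor algebra.\<close>

definition tensor_indices :: "nat \<Rightarrow> (nat \<times> (nat \<Rightarrow> 'e)) set"
  where "tensor_indices D = (SIGMA d:{..D}. PiE {..<d} (\<lambda>_. UNIV))"

text \<open>The canonical map from the truncated tensor algebra to the symmetric algebra. Different
  tensors may give the same polynomial, which leaves the freedom to choose a good lift.\<close>

definition tensor_poly :: "nat \<Rightarrow> (nat \<times> (nat \<Rightarrow> 'e) \<Rightarrow> complex) \<Rightarrow> 'e cpoly"
  where "tensor_poly D t = (\<Sum>x\<in>tensor_indices D. Const (t x) * (\<Prod>s<fst x. Var (snd x s)))"

text \<open>The effect of a linear substitution of the variables on coefficients: the old word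
  \<open>l\<close> contributes to the new word \<open>l'\<close> with the product of the entries
  \<open>A (l s) (l' s)\<close>.\<close>

definition tensor_act ::
    "('e \<Rightarrow> 'e \<Rightarrow> complex) \<Rightarrow> (nat \<times> (nat \<Rightarrow> 'e) \<Rightarrow> complex) \<Rightarrow> nat \<times> (nat \<Rightarrow> 'e) \<Rightarrow> complex"
  where "tensor_act A t = (\<lambda>(d, l').
    \<Sum>l\<in>PiE {..<d} (\<lambda>_. UNIV). t (d, l) * (\<Prod>s<d. A (l s) (l' s)))"

lemma finite_tensor_indices [simp]: "finite (tensor_indices D :: (nat \<times> (nat \<Rightarrow> 'e::finite)) set)"
  by (simp add: tensor_indices_def finite_power_indices)

lemma sum_tensor_indices:
  "(\<Sum>x\<in>tensor_indices D. F x) = (\<Sum>d\<le>D. \<Sum>l\<in>PiE {..<d} (\<lambda>_. UNIV :: 'e::finite set). F (d, l))"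
  by (simp add: tensor_indices_def sum.Sigma finite_power_indices)

lemma tensor_poly_add: "tensor_poly D (\<lambda>x. t x + u x) = tensor_poly D t + tensor_poly D u"
  by (simp add: tensor_poly_def Const_add distrib_right sum.distrib)

lemma tensor_poly_scale: "tensor_poly D (\<lambda>x. c * t x) = Const c * tensor_poly D t"
  by (simp add: tensor_poly_def Const_mult sum_distrib_left mult.assoc)

lemma tensor_poly_diff: "tensor_poly D (\<lambda>x. t x - u x) = tensor_poly D t - tensor_poly D u"
  by (simp add: tensor_poly_def Const_diff left_diff_distrib sum_subtractf)

lemma ex_word_of_monomial:
  "\<exists>l. monomial_value Var a = (\<Prod>e\<leftarrow>l. Var e)"
proof -
  have pow: "\<exists>l. Var v ^ k = (\<Prod>e\<leftarrow>l. Var e)" for v :: 'a and k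
    by (intro exI[of _ "replicate k v"]) simp
  have "\<exists>l. (\<Prod>v\<in>A. Var v ^ Poly_Mapping.lookup a v) = (\<Prod>e\<leftarrow>l. Var e)" if "finite A" for A
    using that
  proof induction
    case empty
    show ?case by (intro exI[of _ "[]"]) simp
  next
    case (insert x F)
    then obtain l where l: "(\<Prod>v\<in>F. Var v ^ Poly_Mapping.lookup a v) = (\<Prod>e\<leftarrow>l. Var e)"
      by blast
    obtain l' where l': "Var x ^ Poly_Mapping.lookup a x = (\<Prod>e\<leftarrow>l'. Var e)"
      using pow by blast
    show ?case
      using insert.hyps l l' by (intro exI[of _ "l' @ l"]) simp
  qed
  then show ?thesis
    by (simp add: monomial_value_def)
qed

lemma ex_tensor_poly:
  fixes f :: "'e::finite cpoly"
  shows "\<exists>D t. f = tensor_poly D t"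
proof -
  \<comment> \<open>Every large bound is allowed so that two summands can be lifted with a common
    one.\<close>
  have "\<exists>D0. \<forall>D\<ge>D0. \<exists>t. f = tensor_poly D t"
  proof (induction f rule: cpoly_induct)
    case (single a c)
    obtain l where l: "monomial_value Var a = (\<Prod>e\<leftarrow>l. Var e)"
      using ex_word_of_monomial by blast
    define x where "x = (length l, restrict (\<lambda>s. l ! s) {..<length l})"
    have "Poly_Mapping.single a c = tensor_poly D (\<lambda>y. if y = x then c else 0)" if "D \<ge> length l" for D
    proof -
      have "x \<in> tensor_indices D"
        using that by (simp add: x_def tensor_indices_def)
      moreover have "tensor_poly D (\<lambda>y. if y = x then c else 0)
          = (\<Sum>y\<in>tensor_indices D. if y = x then Const c * (\<Prod>s<fst x. Var (snd x s)) else 0)"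
        unfolding tensor_poly_def by (intro sum.cong) auto
      ultimately have "tensor_poly D (\<lambda>y. if y = x then c else 0) = Const c * (\<Prod>s<fst x. Var (snd x s))"
        by simp
      also have "(\<Prod>s<fst x. Var (snd x s)) = (\<Prod>e\<leftarrow>l. Var e)"
        by (simp add: x_def prod.list_conv_set_nth atLeast0LessThan)
      finally show ?thesis
        by (simp add: single_eq_monomial_value[of a c] l)
    qed
    then show ?case by blast
  next
    case (add p q)
    then obtain D1 D2 where D: "\<And>D. D \<ge> D1 \<Longrightarrow> \<exists>t. p = tensor_poly D t"
      "\<And>D. D \<ge> D2 \<Longrightarrow> \<exists>t. q = tensor_poly D t"
      by blast
    have "\<exists>t. p + q = tensor_poly D t" if "D \<ge> max D1 D2" for D
    proof -
      have "D1 \<le> D" "D2 \<le> D"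
        using that by simp_all
      then obtain t u where "p = tensor_poly D t" "q = tensor_poly D u"
        using D by blast
      then show ?thesis
        by (intro exI[of _ "\<lambda>x. t x + u x"]) (simp add: tensor_poly_add)
    qed
    then show ?case by blast
  qed
  then show ?thesis by blast
qed

lemma subst_tensor_poly:
  fixes A :: "'e::finite \<Rightarrow> 'e \<Rightarrow> complex"
  shows "subst (\<lambda>e. \<Sum>e'\<in>UNIV. Const (A e e') * Var e') (tensor_poly D t) = tensor_poly D (tensor_act A t)"
proof -
  let ?I = "\<lambda>d. PiE {..<d} (\<lambda>_. UNIV :: 'e set)"
  have prod: "(\<Prod>s<d. \<Sum>e'\<in>UNIV. Const (A (l s) e') * Var e')
      = (\<Sum>l'\<in>?I d. Const (\<Prod>s<d. A (l s) (l' s)) * (\<Prod>s<d. Var (l' s)))" for d and l :: "nat \<Rightarrow> 'e"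
    by (simp add: prod_sum_PiE prod.distrib Const_prod)
  have "subst (\<lambda>e. \<Sum>e'\<in>UNIV. Const (A e e') * Var e') (tensor_poly D t)
    = (\<Sum>d\<le>D. \<Sum>l\<in>?I d. \<Sum>l'\<in>?I d. Const (t (d, l) * (\<Prod>s<d. A (l s) (l' s))) * (\<Prod>s<d. Var (l' s)))"
    by (simp add: tensor_poly_def sum_tensor_indices subst_sum subst_mult subst_prod prod
        sum_distrib_left Const_mult mult.assoc)
  also have "\<dots> = (\<Sum>d\<le>D. \<Sum>l'\<in>?I d. \<Sum>l\<in>?I d. Const (t (d, l) * (\<Prod>s<d. A (l s) (l' s))) * (\<Prod>s<d. Var (l' s)))"
    by (intro sum.cong refl sum.swap)
  also have "\<dots> = tensor_poly D (tensor_act A t)"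
    by (simp add: tensor_poly_def sum_tensor_indices tensor_act_def Const_sum sum_distrib_right)
  finally show ?thesis .
qed

text \<open>The adjoint of a tensor power is the same tensor power of the adjoint, degree by
  degree.\<close>

lemma tensor_act_adjoint:
  fixes A :: "'e::finite \<Rightarrow> 'e \<Rightarrow> complex"
  shows "(\<Sum>x\<in>tensor_indices D. cnj (u x) * tensor_act A w x)
    = (\<Sum>x\<in>tensor_indices D. cnj (tensor_act (\<lambda>e e'. cnj (A e' e)) u x) * w x)"
proof -
  let ?I = "\<lambda>d. PiE {..<d} (\<lambda>_. UNIV :: 'e set)"
  have "(\<Sum>x\<in>tensor_indices D. cnj (u x) * tensor_act A w x)
    = (\<Sum>d\<le>D. \<Sum>l'\<in>?I d. \<Sum>l\<in>?I d. cnj (u (d, l')) * (w (d, l) * (\<Prod>s<d. A (l s) (l' s))))"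
    by (simp add: sum_tensor_indices tensor_act_def sum_distrib_left)
  also have "\<dots> = (\<Sum>d\<le>D. \<Sum>l\<in>?I d. \<Sum>l'\<in>?I d. cnj (u (d, l')) * (w (d, l) * (\<Prod>s<d. A (l s) (l' s))))"
    by (intro sum.cong refl sum.swap)
  also have "\<dots> = (\<Sum>x\<in>tensor_indices D. cnj (tensor_act (\<lambda>e e'. cnj (A e' e)) u x) * w x)"
    by (simp add: sum_tensor_indices tensor_act_def sum_distrib_right sum_distrib_left mult_ac)
  finally show ?thesis .
qed

text \<open>
  Weyl's unitary trick: the orthogonal complement of the tensors representing
  elements of \<open>J\<close> is stable, because the group is closed under adjoints.
\<close>

lemma ex_invariant_tensor:
  fixes f :: "'e::finite cpoly" and \<A> :: "('e \<Rightarrow> 'e \<Rightarrow> complex) set"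
  defines "act \<equiv> \<lambda>A :: 'e \<Rightarrow> 'e \<Rightarrow> complex. subst (\<lambda>e. \<Sum>e'\<in>UNIV. Const (A e e') * Var e')"
  assumes J: "ideal J ring_of_type_algebra"
    and adj: "\<And>A. A \<in> \<A> \<Longrightarrow> (\<lambda>e e'. cnj (A e' e)) \<in> \<A>"
    and stable: "\<And>A p. A \<in> \<A> \<Longrightarrow> p \<in> J \<Longrightarrow> act A p \<in> J"
    and inv: "\<And>A. A \<in> \<A> \<Longrightarrow> act A f - f \<in> J"
  shows "\<exists>D w. f - tensor_poly D w \<in> J
    \<and> (\<forall>A\<in>\<A>. \<forall>x\<in>tensor_indices D. tensor_act A w x = w x)"
proof -
  obtain D t where t: "f = tensor_poly D t"
    using ex_tensor_poly by blast
  let ?L = "tensor_indices D :: (nat \<times> (nat \<Rightarrow> 'e)) set"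
  define V where "V = {t. tensor_poly D t \<in> J}"
  have "\<exists>v\<in>V. \<forall>u\<in>V. (\<Sum>x\<in>?L. cnj (u x) * (t x - v x)) = 0"
  proof (rule orthogonal_projection_exists)
    show "(\<lambda>_. 0) \<in> V"
      by (simp add: V_def tensor_poly_def ideal_zero[OF J])
  qed (simp_all add: V_def tensor_poly_add tensor_poly_scale ideal_add[OF J] ideal_mult_left[OF J])
  then obtain v where v: "v \<in> V" and orth: "\<And>u. u \<in> V \<Longrightarrow> (\<Sum>x\<in>?L. cnj (u x) * (t x - v x)) = 0"
    by blast
  \<comment> \<open>The component of the lift \<open>t\<close> orthogonal to all lifts of elements
    of \<open>J\<close>; it represents \<open>f\<close> modulo \<open>J\<close>.\<close>
  define w where "w = (\<lambda>x. t x - v x)"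
  have w: "tensor_poly D w = f - tensor_poly D v"
    by (simp add: w_def tensor_poly_diff t)
  have vJ: "tensor_poly D v \<in> J"
    using v by (simp add: V_def)
  have "tensor_act A w x = w x" if A: "A \<in> \<A>" and x: "x \<in> ?L" for A x
  proof -
    \<comment> \<open>\<open>h\<close> lifts an element of \<open>J\<close>, since \<open>f\<close>
      is invariant modulo \<open>J\<close> and \<open>J\<close> is stable. Moving the action to the
      other side as its adjoint turns the norm of \<open>h\<close> into inner products of
      \<open>w\<close> with lifts of elements of \<open>J\<close>, so \<open>h\<close>
      vanishes.\<close>
    define h where "h = (\<lambda>x. tensor_act A w x - w x)"
    have "tensor_poly D h = (act A f - f) - (act A (tensor_poly D v) - tensor_poly D v)"
      by (simp add: h_def tensor_poly_diff subst_tensor_poly[symmetric] act_def[symmetric] w)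
        (simp add: act_def subst_diff)
    also have "\<dots> \<in> J"
      by (intro ideal_diff[OF J] inv stable A vJ)
    finally have "tensor_poly D h \<in> J" .
    then have h: "h \<in> V"
      by (simp add: V_def)
    let ?A' = "\<lambda>e e'. cnj (A e' e)"
    have "tensor_poly D (tensor_act ?A' h) = act ?A' (tensor_poly D h)"
      by (simp add: act_def subst_tensor_poly)
    also have "\<dots> \<in> J"
      using stable[OF adj[OF A]] h by (simp add: V_def)
    finally have h': "tensor_act ?A' h \<in> V"
      by (simp add: V_def)
    have "(\<Sum>x\<in>?L. cnj (h x) * h x)
      = (\<Sum>x\<in>?L. cnj (h x) * tensor_act A w x) - (\<Sum>x\<in>?L. cnj (h x) * w x)"
      unfolding sum_subtractf[symmetric] by (simp add: h_def right_diff_distrib)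
    also have "\<dots> = 0"
      using orth[OF h'] orth[OF h] by (simp add: tensor_act_adjoint w_def)
    finally have "h x = 0"
      by (rule sum_cnj_mult_self_eq_0[OF finite_tensor_indices _ x])
    then show ?thesis by (simp add: h_def)
  qed
  moreover have "f - tensor_poly D w \<in> J"
    using vJ by (simp add: w)
  ultimately show ?thesis by blast
qed

section \<open>Products of traces\<close>

lemma sum_PiE_insert:
  fixes B :: "'b::finite set"
  assumes "finite S" "x \<notin> S"
  shows "(\<Sum>a\<in>PiE (insert x S) (\<lambda>_. B). F a) = (\<Sum>a\<in>PiE S (\<lambda>_. B). \<Sum>y\<in>B. F (a(x := y)))"
proof -
  have "(\<Sum>a\<in>PiE (insert x S) (\<lambda>_. B). F a)
    = (\<Sum>(y, a)\<in>B \<times> PiE S (\<lambda>_. B). F (a(x := y)))"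
    unfolding PiE_insert_eq using inj_combinator[OF assms(2), of "\<lambda>_. B"]
    by (simp add: sum.reindex case_prod_unfold)
  also have "\<dots> = (\<Sum>y\<in>B. \<Sum>a\<in>PiE S (\<lambda>_. B). F (a(x := y)))"
    by (simp add: sum.cartesian_product)
  finally show ?thesis
    by (subst (asm) sum.swap)
qed

lemma sum_PiE_pairs:
  "(\<Sum>l\<in>PiE S (\<lambda>_. UNIV :: ('a \<times> 'b) set). F l)
    = (\<Sum>a\<in>PiE S (\<lambda>_. UNIV). \<Sum>b\<in>PiE S (\<lambda>_. UNIV). F (\<lambda>s\<in>S. (a s, b s)))"
proof -
  have "(\<Sum>l\<in>PiE S (\<lambda>_. UNIV :: ('a \<times> 'b) set). F l)
    = (\<Sum>(a, b)\<in>PiE S (\<lambda>_. UNIV) \<times> PiE S (\<lambda>_. UNIV). F (\<lambda>s\<in>S. (a s, b s)))"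
  proof (rule sum.reindex_bij_witness[of _ "\<lambda>(a, b). \<lambda>s\<in>S. (a s, b s)"
        "\<lambda>l. (\<lambda>s\<in>S. fst (l s), \<lambda>s\<in>S. snd (l s))"])
    fix l assume l: "l \<in> PiE S (\<lambda>_. UNIV :: ('a \<times> 'b) set)"
    show "(case (\<lambda>s\<in>S. fst (l s), \<lambda>s\<in>S. snd (l s)) of (a, b) \<Rightarrow> \<lambda>s\<in>S. (a s, b s)) = l"
      using l by (auto simp: fun_eq_iff PiE_iff extensional_def)
    then show "(case (\<lambda>s\<in>S. fst (l s), \<lambda>s\<in>S. snd (l s)) of (a, b) \<Rightarrow> F (\<lambda>s\<in>S. (a s, b s))) = F l"
      by simp
  next
    fix x assume "x \<in> PiE S (\<lambda>_. UNIV :: 'a set) \<times> PiE S (\<lambda>_. UNIV :: 'b set)"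
    then show "(\<lambda>s\<in>S. fst ((case x of (a, b) \<Rightarrow> \<lambda>s\<in>S. (a s, b s)) s),
        \<lambda>s\<in>S. snd ((case x of (a, b) \<Rightarrow> \<lambda>s\<in>S. (a s, b s)) s)) = x"
      by (cases x) (auto simp: fun_eq_iff PiE_iff extensional_def)
  qed auto
  then show ?thesis
    by (simp add: sum.cartesian_product)
qed

text \<open>The trace of the tensor product of the matrices \<open>M s\<close> composed with the
  permutation of the tensor factors by \<pi>, written out in coordinates.\<close>

definition permuted_trace ::
    "'s set \<Rightarrow> ('s \<Rightarrow> 's) \<Rightarrow> ('s \<Rightarrow> 'r::comm_semiring_1 ^ 'n ^ 'n) \<Rightarrow> 'r"
  where "permuted_trace S \<pi> M = (\<Sum>a\<in>PiE S (\<lambda>_. UNIV). \<Prod>s\<in>S. M s $ a s $ a (\<pi> s))"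

lemma permuted_trace_insert_fixed:
  fixes M :: "'s \<Rightarrow> 'r::comm_semiring_1 ^ 'n ^ 'n"
  assumes S: "finite S" "x \<notin> S" and \<pi>: "\<pi> permutes S"
  shows "permuted_trace (insert x S) \<pi> M = trace (M x) * permuted_trace S \<pi> M"
proof -
  have px: "\<pi> x = x"
    using \<pi> S(2) by (rule permutes_not_in)
  have "permuted_trace (insert x S) \<pi> M
    = (\<Sum>a\<in>PiE S (\<lambda>_. UNIV). \<Sum>y\<in>UNIV. M x $ y $ y * (\<Prod>s\<in>S. M s $ a s $ a (\<pi> s)))"
  proof -
    have "(\<Prod>s\<in>insert x S. M s $ (a(x := y)) s $ (a(x := y)) (\<pi> s))
        = M x $ y $ y * (\<Prod>s\<in>S. M s $ a s $ a (\<pi> s))" for a :: "'s \<Rightarrow> 'n" and y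
    proof -
      have "s \<noteq> x" "\<pi> s \<noteq> x" if "s \<in> S" for s
        using that S(2) permutes_in_image[OF \<pi>, of s] by auto
      then show ?thesis
        using S px by (simp cong: prod.cong)
    qed
    then show ?thesis
      unfolding permuted_trace_def by (simp add: sum_PiE_insert[OF S])
  qed
  then show ?thesis
    by (simp add: permuted_trace_def trace_def sum_distrib_left sum_distrib_right)
qed

text \<open>The index at \<open>x\<close> occurs only in the factors of \<open>z\<close> and
  \<open>x\<close>, where \<open>z\<close> precedes \<open>x\<close> in its cycle. Summing over it
  multiplies the two matrices, and the shortened cycle sends \<open>z\<close> directly to
  \<open>\<pi> x\<close>.\<close>

lemma permuted_trace_insert_merge:
  fixes M :: "'s \<Rightarrow> 'r::comm_semiring_1 ^ 'n ^ 'n"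
  assumes S: "finite S" "x \<notin> S" and \<pi>: "\<pi> permutes insert x S" and z: "z \<in> S" "\<pi> z = x"
  shows "permuted_trace (insert x S) \<pi> M
    = permuted_trace S (Transposition.transpose x (\<pi> x) \<circ> \<pi>) (M(z := M z ** M x))"
proof -
  let ?\<pi>' = "Transposition.transpose x (\<pi> x) \<circ> \<pi>"
  have zx: "z \<noteq> x" using z S by auto
  have inj: "\<pi> s = \<pi> t \<longleftrightarrow> s = t" for s t
    using permutes_inj[OF \<pi>] by (auto dest: injD)
  have px: "\<pi> x \<noteq> x"
    using inj[of x z] z zx by auto
  have \<pi>'z: "?\<pi>' z = \<pi> x"
    using z by simp
  have \<pi>'s: "?\<pi>' s = \<pi> s" "\<pi> s \<noteq> x" if "s \<in> S" "s \<noteq> z" for s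
  proof -
    show "\<pi> s \<noteq> x"
      using inj[of s z] z that by simp
    moreover have "\<pi> s \<noteq> \<pi> x"
      using inj[of s x] that S by auto
    ultimately show "?\<pi>' s = \<pi> s"
      by (simp add: Transposition.transpose_def)
  qed
  have step: "(\<Sum>y\<in>UNIV. \<Prod>s\<in>insert x S. M s $ (a(x := y)) s $ (a(x := y)) (\<pi> s))
      = (\<Prod>s\<in>S. (M(z := M z ** M x)) s $ a s $ a (?\<pi>' s))" for a :: "'s \<Rightarrow> 'n"
  proof -
    let ?R = "\<Prod>s\<in>S - {z}. M s $ a s $ a (\<pi> s)"
    have "(\<Prod>s\<in>S - {z}. M s $ (a(x := y)) s $ (a(x := y)) (\<pi> s)) = ?R" for y
    proof (rule prod.cong[OF refl])
      fix s assume "s \<in> S - {z}"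
      then show "M s $ (a(x := y)) s $ (a(x := y)) (\<pi> s) = M s $ a s $ a (\<pi> s)"
        using \<pi>'s(2)[of s] S by auto
    qed
    then have "(\<Prod>s\<in>insert x S. M s $ (a(x := y)) s $ (a(x := y)) (\<pi> s))
        = (M z $ a z $ y * M x $ y $ a (\<pi> x)) * ?R" for y
      using S z zx px by (simp add: prod.remove[of S z] mult_ac)
    moreover have "(\<Prod>s\<in>S - {z}. (M(z := M z ** M x)) s $ a s $ a (?\<pi>' s)) = ?R"
    proof (rule prod.cong[OF refl])
      fix s assume "s \<in> S - {z}"
      then show "(M(z := M z ** M x)) s $ a s $ a (?\<pi>' s) = M s $ a s $ a (\<pi> s)"
        using \<pi>'s(1)[of s] by (simp del: o_apply)
    qed
    then have "(\<Prod>s\<in>S. (M(z := M z ** M x)) s $ a s $ a (?\<pi>' s)) = (M z ** M x) $ a z $ a (\<pi> x) * ?R"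
      using S z \<pi>'z by (simp add: prod.remove[of S z] del: o_apply)
    ultimately show ?thesis
      by (simp add: matrix_matrix_mult_def sum_distrib_right)
  qed
  show ?thesis
    unfolding permuted_trace_def by (simp only: sum_PiE_insert[OF S] step)
qed

lemma permutes_transpose_comp:
  assumes "\<pi> permutes insert x S"
  shows "Transposition.transpose x (\<pi> x) \<circ> \<pi> permutes S"
proof (rule permutes_superset)
  show "Transposition.transpose x (\<pi> x) \<circ> \<pi> permutes insert x S"
    using assms permutes_in_image[OF assms, of x]
    by (intro permutes_compose permutes_swap_id) auto
  show "(Transposition.transpose x (\<pi> x) \<circ> \<pi>) y = y" if "y \<in> insert x S - S" for y
  proof -
    have "y = x" using that by blast
    then show ?thesis by simp
  qed
qed

text \<open>Contracting the cycles of \<open>\<pi>\<close> one element at a time turns the sum into a product of traces.\<close>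

lemma permuted_trace_eq_prod_traces:
  fixes M :: "'s \<Rightarrow> 'r::comm_semiring_1 ^ 'n ^ 'n"
  assumes "finite S" "\<pi> permutes S" "\<And>s. s \<in> S \<Longrightarrow> M s \<in> W"
    and W: "\<And>A B. A \<in> W \<Longrightarrow> B \<in> W \<Longrightarrow> A ** B \<in> W"
  shows "\<exists>As. set As \<subseteq> W \<and> permuted_trace S \<pi> M = (\<Prod>A\<leftarrow>As. trace A)"
  using assms(1-3)
proof (induction S arbitrary: \<pi> M rule: finite_induct)
  case empty
  then show ?case
    by (intro exI[of _ "[]"]) (simp add: permuted_trace_def)
next
  case (insert x S)
  show ?case
  proof (cases "\<pi> x = x")
    case True
    then have \<pi>: "\<pi> permutes S"
      using insert.prems(1) permutes_superset by fastforce
    then obtain As where "set As \<subseteq> W" "permuted_trace S \<pi> M = (\<Prod>A\<leftarrow>As. trace A)"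
      using insert.IH[OF \<pi>, of M] insert.prems(2) by auto
    then show ?thesis
      using insert.prems(2) permuted_trace_insert_fixed[OF insert.hyps(1,2) \<pi>, of M]
      by (intro exI[of _ "M x # As"]) simp
  next
    case False
    obtain z where z: "\<pi> z = x"
      using permutes_surj[OF insert.prems(1)] by (metis surjD)
    then have zS: "z \<in> S"
      using permutes_in_image[OF insert.prems(1), of z] False by auto
    let ?M' = "M(z := M z ** M x)"
    have "\<exists>As. set As \<subseteq> W \<and> permuted_trace S (Transposition.transpose x (\<pi> x) \<circ> \<pi>) ?M'
        = (\<Prod>A\<leftarrow>As. trace A)"
      by (rule insert.IH[OF permutes_transpose_comp[OF insert.prems(1)]])
        (use insert.prems(2) zS W in auto)
    then show ?thesis
      by (simp only: permuted_trace_insert_merge[OF insert.hyps(1,2) insert.prems(1) zS z])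
  qed
qed

section \<open>The action of the general linear group\<close>

lemma matrix_inv_mult:
  assumes "invertible (g :: 'a::semiring_1 ^ 'n ^ 'n)"
  shows "g ** matrix_inv g = mat 1" "matrix_inv g ** g = mat 1"
proof -
  have "g ** matrix_inv g = mat 1 \<and> matrix_inv g ** g = mat 1"
    unfolding matrix_inv_def using assms unfolding invertible_def by (rule someI_ex)
  then show "g ** matrix_inv g = mat 1" "matrix_inv g ** g = mat 1"
    by simp_all
qed

lemma matrix_inv_eqI:
  fixes g h :: "'a::semiring_1 ^ 'n ^ 'n"
  assumes "g ** h = mat 1" "h ** g = mat 1"
  shows "invertible g" "matrix_inv g = h"
proof -
  show "invertible g"
    using assms by (auto simp: invertible_def)
  then show "matrix_inv g = h"
    by (metis assms(2) matrix_inv_mult(1) matrix_mul_assoc matrix_mul_lid matrix_mul_rid)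
qed

lemma matrix_mult_nth: "(A ** B) $ i $ j = (\<Sum>k\<in>UNIV. A $ i $ k * B $ k $ j)"
  by (simp add: matrix_matrix_mult_def)

lemma map_matrix_subst_mult:
  "map_matrix (subst \<sigma>) (A ** B) = map_matrix (subst \<sigma>) A ** map_matrix (subst \<sigma>) B"
  by (simp add: vec_eq_iff matrix_mult_nth subst_sum subst_mult)

lemma map_matrix_subst_diff:
  "map_matrix (subst \<sigma>) (A - B) = map_matrix (subst \<sigma>) A - map_matrix (subst \<sigma>) B"
  by (simp add: vec_eq_iff subst_diff)

lemma map_matrix_subst_mat1: "map_matrix (subst \<sigma>) (mat 1) = mat 1"
  by (simp add: vec_eq_iff mat_def)

lemma map_matrix_Const_mult: "map_matrix Const (g ** h) = map_matrix Const g ** map_matrix Const h"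
  by (simp add: vec_eq_iff matrix_mult_nth Const_sum Const_mult)

lemma map_matrix_Const_mat1: "map_matrix Const (mat 1) = mat 1"
  by (simp add: vec_eq_iff mat_def)

lemma map_matrix_Const_inv:
  fixes g :: "complex ^ 'n ^ 'n"
  assumes "invertible g"
  shows "map_matrix Const (matrix_inv g) ** map_matrix Const g = mat 1"
    "map_matrix Const g ** map_matrix Const (matrix_inv g) = mat 1"
  by (simp_all add: map_matrix_Const_mult[symmetric] matrix_inv_mult[OF assms] map_matrix_Const_mat1)

definition conjugate :: "complex ^ 'n ^ 'n \<Rightarrow> 'v cpoly ^ 'n ^ 'n \<Rightarrow> 'v cpoly ^ 'n ^ 'n"
  where "conjugate g A = map_matrix Const (matrix_inv g) ** A ** map_matrix Const g"

lemma conjugate_mult: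
  assumes "invertible g"
  shows "conjugate g (A ** B) = conjugate g A ** conjugate g B"
proof -
  let ?g = "map_matrix Const g" and ?h = "map_matrix Const (matrix_inv g)"
  have "conjugate g A ** conjugate g B = ?h ** A ** (?g ** ?h) ** B ** ?g"
    by (simp add: conjugate_def matrix_mul_assoc)
  then show ?thesis
    by (simp add: map_matrix_Const_inv[OF assms] conjugate_def matrix_mul_assoc)
qed

lemma conjugate_mat1: "invertible g \<Longrightarrow> conjugate g (mat 1) = mat 1"
  by (simp add: conjugate_def map_matrix_Const_inv)

lemma conjugate_diff: "conjugate g (A - B) = conjugate g A - conjugate g B"
  by (simp add: conjugate_def vec_eq_iff matrix_mult_nth right_diff_distrib left_diff_distrib
      sum_subtractf)

lemma map_matrix_GL_act_generic: "map_matrix (GL_act g) (generic_matrix k) = conjugate g (generic_matrix k)"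
  by (simp add: vec_eq_iff GL_act_def generic_matrix_def conjugate_def)

lemma GL_act_hom:
  shows GL_act_add: "GL_act g (p + q) = GL_act g p + GL_act g q"
    and GL_act_diff: "GL_act g (p - q) = GL_act g p - GL_act g q"
    and GL_act_mult: "GL_act g (p * q) = GL_act g p * GL_act g q"
    and GL_act_sum: "GL_act g (sum F A) = (\<Sum>x\<in>A. GL_act g (F x))"
    and GL_act_prod: "GL_act g (prod F A) = (\<Prod>x\<in>A. GL_act g (F x))"
    and GL_act_Const: "GL_act g (Const c) = Const c"
    and GL_act_of_int: "GL_act g (of_int n) = of_int n"
  by (simp_all add: GL_act_def subst_add subst_diff subst_mult subst_sum subst_prod)

text \<open>Puts the action into the form of a linear substitution, as required for acting on
  tensors. The coefficient of the \<open>(i', j')\<close> entry in the \<open>(i, j)\<close> entry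
  of the conjugate is a product of one entry of the inverse and one of \<open>g\<close>; the matrix
  label \<open>k\<close> is kept.\<close>

lemma GL_act_linear:
  fixes g :: "complex ^ 'n ^ 'n"
  shows "(GL_act g :: ('m::finite, 'n) rep_poly \<Rightarrow> _) = subst (\<lambda>e. \<Sum>e'\<in>UNIV. Const (case (e, e') of ((k, i, j), (k', i', j')) \<Rightarrow>
    if k' = k then matrix_inv g $ i $ i' * g $ j' $ j else 0) * Var e')"
proof -
  have "(map_matrix Const (matrix_inv g) ** generic_matrix k ** map_matrix Const g) $ i $ j
    = (\<Sum>e'\<in>UNIV. Const (case ((k, i, j), e') of ((k, i, j), (k', i', j')) \<Rightarrow>
        if k' = k then matrix_inv g $ i $ i' * g $ j' $ j else 0) * Var e')" for k :: 'm and i j :: 'n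
  proof -
    have "(\<Sum>e'\<in>UNIV. Const (case ((k, i, j), e') of ((k, i, j), (k', i', j')) \<Rightarrow>
        if k' = k then matrix_inv g $ i $ i' * g $ j' $ j else 0) * Var e')
      = (\<Sum>k'\<in>UNIV. \<Sum>i'\<in>UNIV. \<Sum>j'\<in>UNIV.
          Const (if k' = k then matrix_inv g $ i $ i' * g $ j' $ j else 0) * Var (k', i', j'))"
      by (simp add: UNIV_Times_UNIV[symmetric] sum.cartesian_product' del: UNIV_Times_UNIV)
    also have "\<dots> = (\<Sum>k'\<in>UNIV. if k' = k then \<Sum>i'\<in>UNIV. \<Sum>j'\<in>UNIV.
          Const (matrix_inv g $ i $ i' * g $ j' $ j) * Var (k, i', j') else 0)"
      by (intro sum.cong refl) auto
    also have "\<dots> = (\<Sum>i'\<in>UNIV. \<Sum>j'\<in>UNIV. Const (matrix_inv g $ i $ i' * g $ j' $ j) * Var (k, i', j'))"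
      by simp
    also have "\<dots> = (\<Sum>j'\<in>UNIV. \<Sum>i'\<in>UNIV. Const (matrix_inv g $ i $ i' * g $ j' $ j) * Var (k, i', j'))"
      by (rule sum.swap)
    also have "\<dots> = (map_matrix Const (matrix_inv g) ** generic_matrix k ** map_matrix Const g) $ i $ j"
      by (simp add: matrix_mult_nth generic_matrix_def Const_mult sum_distrib_right sum_distrib_left
          mult_ac)
    finally show ?thesis by simp
  qed
  then show ?thesis
    unfolding GL_act_def by (intro arg_cong[of _ _ subst] ext) (auto split: prod.split)
qed

lemma ideal_comm_ideal: "ideal comm_ideal ring_of_type_algebra"
  unfolding comm_ideal_def by (rule ring.genideal_ideal) (auto simp: ring_from_type_algebra)

lemma commutator_in_comm_ideal:
  "(generic_matrix k ** generic_matrix l - generic_matrix l ** generic_matrix k) $ i $ j \<in> comm_ideal"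
proof -
  have "commutator_entries \<subseteq> (comm_ideal :: ('a, 'b) rep_poly set)"
    unfolding comm_ideal_def by (rule ring.genideal_self) (auto simp: ring_from_type_algebra)
  then show ?thesis
    unfolding commutator_entries_def by blast
qed

text \<open>Conjugation is multiplicative, so a commutator of generic matrices goes to its
  conjugate, whose entries are constant combinations of commutator entries.\<close>

lemma GL_act_comm_ideal:
  fixes g :: "complex ^ 'n ^ 'n" and p :: "('m::finite, 'n) rep_poly"
  assumes g: "invertible g" and p: "p \<in> comm_ideal"
  shows "GL_act g p \<in> comm_ideal"
proof -
  have "GL_act g s \<in> comm_ideal" if "s \<in> commutator_entries" for s :: "('m, 'n) rep_poly"
  proof -
    from that obtain k l i j
      where s: "s = (generic_matrix k ** generic_matrix l - generic_matrix l ** generic_matrix k) $ i $ j"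
      unfolding commutator_entries_def by blast
    let ?C = "generic_matrix k ** generic_matrix l - generic_matrix l ** generic_matrix k :: ('m, 'n) rep_poly ^ 'n ^ 'n"
    have "map_matrix (GL_act g) ?C = conjugate g ?C"
      by (simp only: GL_act_def map_matrix_subst_diff map_matrix_subst_mult)
        (simp only: GL_act_def[symmetric] map_matrix_GL_act_generic conjugate_mult[OF g] conjugate_diff)
    then have "GL_act g s = conjugate g ?C $ i $ j"
      unfolding s nth_map_matrix[symmetric] by simp
    also have "\<dots> \<in> comm_ideal"
      unfolding conjugate_def matrix_mult_nth
      by (intro ideal_sum[OF ideal_comm_ideal] ideal_mult_right[OF ideal_comm_ideal]
          ideal_mult_left[OF ideal_comm_ideal] commutator_in_comm_ideal)
    finally show ?thesis .
  qed
  note gen = this[unfolded GL_act_def]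
  show ?thesis
    unfolding GL_act_def by (rule subst_genideal[OF ideal_comm_ideal gen p[unfolded comm_ideal_def]])
qed

primrec word_matrix :: "'m list \<Rightarrow> ('m, 'n::finite) rep_poly ^ 'n ^ 'n"
  where
    "word_matrix [] = mat 1"
  | "word_matrix (k # w) = generic_matrix k ** word_matrix w"

lemma word_matrix_append: "word_matrix (u @ w) = word_matrix u ** word_matrix w"
  by (induction u) (simp_all add: matrix_mul_assoc)

lemma word_matrix_single: "word_matrix [k] = generic_matrix k"
  by simp

lemma GL_act_word_matrix:
  assumes "invertible g"
  shows "map_matrix (GL_act g) (word_matrix w) = conjugate g (word_matrix w)"
proof (induction w)
  case Nil
  then show ?case
    using map_matrix_subst_mat1 by (simp add: GL_act_def conjugate_mat1[OF assms])
next
  case (Cons k w)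
  have "map_matrix (GL_act g) (word_matrix (k # w))
    = map_matrix (GL_act g) (generic_matrix k) ** map_matrix (GL_act g) (word_matrix w)"
    by (simp add: GL_act_def map_matrix_subst_mult)
  then show ?case
    by (simp add: Cons.IH map_matrix_GL_act_generic conjugate_mult[OF assms])
qed

text \<open>Closure of the group under adjoints, for the unitary trick. The entries of the inverse
  are recorded too, because the coefficients of the action involve \<open>g\<close> and its
  inverse.\<close>

lemma ex_GL_adjoint:
  fixes g :: "complex ^ 'n ^ 'n"
  assumes "invertible g"
  shows "\<exists>h. invertible h \<and> (\<forall>i j. h $ i $ j = cnj (g $ j $ i) \<and>
    matrix_inv h $ i $ j = cnj (matrix_inv g $ j $ i))"
proof -
  let ?h = "\<chi> i j. cnj (g $ j $ i)" and ?h' = "\<chi> i j. cnj (matrix_inv g $ j $ i)"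
  have "?h ** ?h' = (\<chi> i j. cnj ((matrix_inv g ** g) $ j $ i))"
    "?h' ** ?h = (\<chi> i j. cnj ((g ** matrix_inv g) $ j $ i))"
    by (simp_all add: vec_eq_iff matrix_mult_nth mult.commute)
  then have "?h ** ?h' = mat 1" "?h' ** ?h = mat 1"
    by (auto simp: matrix_inv_mult[OF assms] vec_eq_iff mat_def)
  from matrix_inv_eqI[OF this] show ?thesis
    by (intro exI[of _ ?h]) simp
qed

section \<open>From invariant tensors to products of traces\<close>

lemma sum_PiE_triples:
  "(\<Sum>l\<in>PiE S (\<lambda>_. UNIV :: ('a \<times> 'b \<times> 'c) set). F l)
    = (\<Sum>k\<in>PiE S (\<lambda>_. UNIV). \<Sum>a\<in>PiE S (\<lambda>_. UNIV). \<Sum>b\<in>PiE S (\<lambda>_. UNIV).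
        F (\<lambda>s\<in>S. (k s, a s, b s)))"
proof -
  have "(\<lambda>s\<in>S. (k s, (\<lambda>s\<in>S. (a s, b s)) s)) = (\<lambda>s\<in>S. (k s, a s, b s))" for k :: "_ \<Rightarrow> 'a" and a :: "_ \<Rightarrow> 'b" and b :: "_ \<Rightarrow> 'c"
    by (auto simp: restrict_def fun_eq_iff)
  then show ?thesis
    by (simp only: sum_PiE_pairs)
qed

lemma PiE_eqI_iff:
  assumes "a \<in> PiE S (\<lambda>_. B)" "b \<in> PiE S (\<lambda>_. B)"
  shows "(\<forall>s\<in>S. a s = b s) \<longleftrightarrow> a = b"
  using assms by (auto intro: PiE_ext)

lemma prod_mat1_PiE:
  assumes "finite S" "a \<in> PiE S (\<lambda>_. UNIV)" "b \<in> PiE S (\<lambda>_. UNIV)"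
  shows "(\<Prod>s\<in>S. (mat 1 :: 'a::comm_semiring_1 ^ 'n ^ 'n) $ a s $ b s) = (if a = b then 1 else 0)"
proof -
  have "(\<Prod>s\<in>S. (mat 1 :: 'a ^ 'n ^ 'n) $ a s $ b s) = (if \<forall>s\<in>S. a s = b s then 1 else 0)"
    using assms(1) by (auto simp: mat_def intro!: prod_zero)
  then show ?thesis
    by (simp only: PiE_eqI_iff[OF assms(2,3)])
qed

lemma prod_matrix_mult_PiE:
  fixes g h :: "'a::comm_semiring_1 ^ 'n ^ 'n"
  assumes "finite S"
  shows "(\<Sum>b\<in>PiE S (\<lambda>_. UNIV). (\<Prod>s\<in>S. g $ a s $ b s) * (\<Prod>s\<in>S. h $ b s $ c s))
    = (\<Prod>s\<in>S. (g ** h) $ a s $ c s)"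
  using assms by (simp add: matrix_mult_nth prod_sum_PiE prod.distrib)

text \<open>With tensor powers understood, the hypothesis says that \<open>T\<close> equals its
  conjugate by the transpose of \<open>g\<close>, because coefficients transform by the transposed
  matrices. Hence \<open>g\<close> is taken to be the transpose of \<open>h\<close>.\<close>

lemma invariant_kernel_commutes:
  fixes T :: "('s \<Rightarrow> 'n::finite) \<Rightarrow> ('s \<Rightarrow> 'n) \<Rightarrow> complex" and S :: "'s set"
  defines "I \<equiv> PiE S (\<lambda>_. UNIV)"
  assumes S: "finite S"
    and inv: "\<And>(g :: complex ^ 'n ^ 'n) a' b'. invertible g \<Longrightarrow> a' \<in> I \<Longrightarrow> b' \<in> I \<Longrightarrow>
      T a' b' = (\<Sum>a\<in>I. \<Sum>b\<in>I. T a b * (\<Prod>s\<in>S. matrix_inv g $ a s $ a' s * g $ b' s $ b s))"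
    and h: "invertible (h :: complex ^ 'n ^ 'n)" and mem: "a \<in> I" "c \<in> I"
  shows "(\<Sum>b\<in>I. T a b * (\<Prod>s\<in>S. h $ b s $ c s)) = (\<Sum>b\<in>I. (\<Prod>s\<in>S. h $ a s $ b s) * T b c)"
proof -
  let ?g = "Finite_Cartesian_Product.transpose h"
  have g: "invertible ?g"
    by (rule matrix_inv_eqI(1)[of _ "Finite_Cartesian_Product.transpose (matrix_inv h)"])
      (simp_all add: matrix_transpose_mul[symmetric] matrix_inv_mult[OF h])
  have finI: "finite I"
    using S by (simp add: I_def finite_power_indices)
  have "(\<Sum>b\<in>I. (\<Prod>s\<in>S. h $ a s $ b s) * T b c)
    = (\<Sum>b\<in>I. \<Sum>a'\<in>I. \<Sum>c'\<in>I. T a' c' * (\<Prod>s\<in>S. h $ c' s $ c s) *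
        ((\<Prod>s\<in>S. matrix_inv ?g $ a' s $ b s) * (\<Prod>s\<in>S. ?g $ b s $ a s)))"
    by (intro sum.cong refl, subst inv[OF g _ mem(2)])
      (simp_all add: sum_distrib_left prod.distrib transpose_def mult_ac)
  also have "\<dots> = (\<Sum>a'\<in>I. \<Sum>b\<in>I. \<Sum>c'\<in>I. T a' c' * (\<Prod>s\<in>S. h $ c' s $ c s) *
        ((\<Prod>s\<in>S. matrix_inv ?g $ a' s $ b s) * (\<Prod>s\<in>S. ?g $ b s $ a s)))"
    by (rule sum.swap)
  also have "\<dots> = (\<Sum>a'\<in>I. \<Sum>c'\<in>I. \<Sum>b\<in>I. T a' c' * (\<Prod>s\<in>S. h $ c' s $ c s) *
        ((\<Prod>s\<in>S. matrix_inv ?g $ a' s $ b s) * (\<Prod>s\<in>S. ?g $ b s $ a s)))"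
    by (intro sum.cong refl sum.swap)
  also have "\<dots> = (\<Sum>a'\<in>I. \<Sum>c'\<in>I. T a' c' * (\<Prod>s\<in>S. h $ c' s $ c s) *
        (\<Prod>s\<in>S. (matrix_inv ?g ** ?g) $ a' s $ a s))"
    by (simp only: sum_distrib_left[symmetric] prod_matrix_mult_PiE[OF S] I_def)
  also have "\<dots> = (\<Sum>a'\<in>I. \<Sum>c'\<in>I. T a' c' * (\<Prod>s\<in>S. h $ c' s $ c s) * (if a' = a then 1 else 0))"
    using mem by (intro sum.cong refl) (simp add: matrix_inv_mult[OF g] prod_mat1_PiE[OF S] I_def)
  also have "\<dots> = (\<Sum>a'\<in>I. if a' = a then \<Sum>c'\<in>I. T a c' * (\<Prod>s\<in>S. h $ c' s $ c s) else 0)"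
    by (intro sum.cong refl) auto
  also have "\<dots> = (\<Sum>b\<in>I. T a b * (\<Prod>s\<in>S. h $ b s $ c s))"
    using finI mem by simp
  finally show ?thesis by simp
qed

lemma Const_mult_indicator:
  "Const (c * (if Q then 1 else 0)) * p = (if Q then Const c * p else 0)"
  by simp

text \<open>The scalar is built into the generators, so closure under addition suffices for a linear
  span and induction has two cases. The empty list of words gives the constants.\<close>

inductive_set trace_span :: "('m, 'n::finite) rep_poly set"
  where
    gen: "Const c * (\<Prod>w\<leftarrow>ws. trace (word_matrix w)) \<in> trace_span"
  | add: "p \<in> trace_span \<Longrightarrow> q \<in> trace_span \<Longrightarrow> p + q \<in> trace_span"

lemma trace_span_sum: "(\<And>x. x \<in> A \<Longrightarrow> F x \<in> trace_span) \<Longrightarrow> sum F A \<in> trace_span"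
proof (induction A rule: infinite_finite_induct)
  case (insert x A)
  then show ?case by (simp add: trace_span.add)
qed (use trace_span.gen[of 0 "[]"] in auto)

text \<open>The word matrices contain the generic matrices and are closed under products, so
  contracting the cycles of \<pi> leaves traces of words.\<close>

lemma Const_mult_permuted_trace_in_trace_span:
  fixes ks :: "'s \<Rightarrow> 'm"
  assumes "finite S" "\<pi> permutes S"
  shows "Const c * permuted_trace S \<pi> (\<lambda>s. generic_matrix (ks s)) \<in> (trace_span :: ('m, 'n::finite) rep_poly set)"
proof -
  have "\<exists>As. set As \<subseteq> range word_matrix \<and>
    permuted_trace S \<pi> (\<lambda>s. generic_matrix (ks s) :: ('m, 'n) rep_poly ^ 'n ^ 'n) = (\<Prod>A\<leftarrow>As. trace A)"
  proof (rule permuted_trace_eq_prod_traces[OF assms])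
    show "generic_matrix k \<in> range word_matrix" for k
      using word_matrix_single by (metis rangeI)
    show "A ** B \<in> range word_matrix" if "A \<in> range word_matrix" "B \<in> range word_matrix"
      for A B :: "('m, 'n) rep_poly ^ 'n ^ 'n"
      using that by (auto simp: word_matrix_append[symmetric])
  qed
  then obtain As where As: "set As \<subseteq> range word_matrix" and
    eq: "permuted_trace S \<pi> (\<lambda>s. generic_matrix (ks s) :: ('m, 'n) rep_poly ^ 'n ^ 'n) = (\<Prod>A\<leftarrow>As. trace A)"
    by (elim exE conjE)
  have "\<exists>ws. As = map word_matrix ws"
    unfolding ex_map_conv using As by blast
  then obtain ws where "As = map word_matrix ws" ..
  then show ?thesis
    using trace_span.gen[of c ws] by (simp add: eq o_def)
qed

text \<open>The first fundamental theorem for tuples of matrices under conjugation, modulo the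
  commutators. The action keeps the sequence of labels \<open>ks\<close> of a word, so an invariant
  tensor splits into kernels \<open>T\<close>, one for each \<open>ks\<close>, to which Schur--Weyl
  duality applies.\<close>

theorem GL_invariant_mod_comm_ideal_trace_span:
  fixes f :: "('m::finite, 'n::finite) rep_poly"
  assumes inv: "\<And>g :: complex ^ 'n ^ 'n. invertible g \<Longrightarrow> GL_act g f - f \<in> comm_ideal"
  shows "\<exists>p\<in>trace_span. f - p \<in> comm_ideal"
proof -
  define A :: "complex ^ 'n ^ 'n \<Rightarrow> 'm \<times> 'n \<times> 'n \<Rightarrow> 'm \<times> 'n \<times> 'n \<Rightarrow> complex"
    where "A = (\<lambda>g e e'. case (e, e') of ((k, i, j), (k', i', j')) \<Rightarrow>
      if k' = k then matrix_inv g $ i $ i' * g $ j' $ j else 0)"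
  have act: "subst (\<lambda>e. \<Sum>e'\<in>UNIV. Const (A g e e') * Var e') = GL_act g" for g
    unfolding GL_act_linear A_def by simp
  have "\<exists>D w. f - tensor_poly D w \<in> comm_ideal
    \<and> (\<forall>A\<in>{A g | g. invertible g}. \<forall>x\<in>tensor_indices D. tensor_act A w x = w x)"
  proof (rule ex_invariant_tensor[OF ideal_comm_ideal])
    fix B assume "B \<in> {A g | g. invertible g}"
    then obtain g where g: "invertible g" "B = A g" by blast
    obtain h where h: "invertible h" "\<And>i j. h $ i $ j = cnj (g $ j $ i)"
      "\<And>i j. matrix_inv h $ i $ j = cnj (matrix_inv g $ j $ i)"
      using ex_GL_adjoint[OF g(1)] by blast
    have "(\<lambda>e e'. cnj (B e' e)) = A h"
      by (auto simp: g(2) A_def h fun_eq_iff)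
    then show "(\<lambda>e e'. cnj (B e' e)) \<in> {A g | g. invertible g}"
      using h(1) by blast
    show "subst (\<lambda>e. \<Sum>e'\<in>UNIV. Const (B e e') * Var e') f - f \<in> comm_ideal"
      unfolding g(2) act by (rule inv[OF g(1)])
    show "subst (\<lambda>e. \<Sum>e'\<in>UNIV. Const (B e e') * Var e') p \<in> comm_ideal" if "p \<in> comm_ideal" for p
      unfolding g(2) act by (rule GL_act_comm_ideal[OF g(1) that])
  qed
  then obtain D w where f: "f - tensor_poly D w \<in> comm_ideal"
    and w: "\<And>g x. invertible g \<Longrightarrow> x \<in> tensor_indices D \<Longrightarrow> tensor_act (A g) w x = w x"
    by blast
  have "(\<Sum>a\<in>PiE {..<d} (\<lambda>_. UNIV). \<Sum>b\<in>PiE {..<d} (\<lambda>_. UNIV).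
      Const (w (d, \<lambda>s\<in>{..<d}. (ks s, a s, b s))) * (\<Prod>s<d. Var (ks s, a s, b s))) \<in> trace_span"
    if d: "d \<le> D" and ks: "ks \<in> PiE {..<d} (\<lambda>_. UNIV)" for d ks
  proof -
    let ?I = "PiE {..<d} (\<lambda>_. UNIV :: 'n set)"
    have finI: "finite ?I" and finK: "finite (PiE {..<d} (\<lambda>_. UNIV :: 'm set))"
      by (simp_all add: finite_power_indices)
    define T where "T = (\<lambda>a b. w (d, \<lambda>s\<in>{..<d}. (ks s, a s, b s)))"
    have T: "T a' b' = (\<Sum>a\<in>?I. \<Sum>b\<in>?I. T a b * (\<Prod>s<d. matrix_inv g $ a s $ a' s * g $ b' s $ b s))"
      if g: "invertible g" and mem: "a' \<in> ?I" "b' \<in> ?I" for g a' b'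
    proof -
      let ?x = "(d, \<lambda>s\<in>{..<d}. (ks s, a' s, b' s))"
      let ?F = "\<lambda>k. \<Sum>a\<in>?I. \<Sum>b\<in>?I. w (d, \<lambda>s\<in>{..<d}. (k s, a s, b s)) *
          (\<Prod>s<d. matrix_inv g $ a s $ a' s * g $ b' s $ b s)"
      \<comment> \<open>A single position with different labels contributes the factor 0.\<close>
      have prod: "(\<Prod>s<d. A g (k s, a s, b s) (ks s, a' s, b' s))
          = (if k = ks then \<Prod>s<d. matrix_inv g $ a s $ a' s * g $ b' s $ b s else 0)"
        if k: "k \<in> PiE {..<d} (\<lambda>_. UNIV)" for k a b
      proof (cases "k = ks")
        case True
        then show ?thesis by (simp add: A_def)
      next
        case False
        then obtain s where "s < d" "k s \<noteq> ks s"
          using PiE_eqI_iff[OF k ks] by auto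
        then show ?thesis
          using False by (intro trans[OF prod_zero]) (auto simp: A_def intro!: bexI[of _ s])
      qed
      have "?x \<in> tensor_indices D"
        using d by (simp add: tensor_indices_def)
      then have "w ?x = tensor_act (A g) w ?x"
        using w[OF g] by simp
      also have "\<dots> = (\<Sum>l\<in>PiE {..<d} (\<lambda>_. UNIV). w (d, l) * (\<Prod>s<d. A g (l s) (ks s, a' s, b' s)))"
        by (simp add: tensor_act_def)
      also have "\<dots> = (\<Sum>k\<in>PiE {..<d} (\<lambda>_. UNIV). \<Sum>a\<in>?I. \<Sum>b\<in>?I.
          w (d, \<lambda>s\<in>{..<d}. (k s, a s, b s)) * (\<Prod>s<d. A g (k s, a s, b s) (ks s, a' s, b' s)))"
        by (simp add: sum_PiE_triples)
      also have "\<dots> = (\<Sum>k\<in>PiE {..<d} (\<lambda>_. UNIV). if k = ks then ?F k else 0)"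
        by (intro sum.cong refl) (simp add: prod)
      also have "\<dots> = ?F ks"
        using ks finK by simp
      finally show ?thesis
        by (simp only: T_def)
    qed
    obtain \<gamma> where "\<forall>a\<in>?I. \<forall>b\<in>?I.
        T a b = (\<Sum>\<pi> | \<pi> permutes {..<d}. \<gamma> \<pi> * (if b = a \<circ> \<pi> then 1 else 0))"
      using commutes_with_GL_imp_permutation_operator[OF finite_lessThan
          invariant_kernel_commutes[OF finite_lessThan T]] by (rule exE)
    then have \<gamma>: "T a b = (\<Sum>\<pi> | \<pi> permutes {..<d}. \<gamma> \<pi> * (if b = a \<circ> \<pi> then 1 else 0))"
      if "a \<in> ?I" "b \<in> ?I" for a b
      using that by blast
    let ?P = "\<lambda>a b. \<Prod>s<d. Var (ks s, a s, b s) :: ('m, 'n) rep_poly"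
    have "(\<Sum>a\<in>?I. \<Sum>b\<in>?I. Const (T a b) * ?P a b)
      = (\<Sum>a\<in>?I. \<Sum>b\<in>?I. \<Sum>\<pi> | \<pi> permutes {..<d}. if b = a \<circ> \<pi> then Const (\<gamma> \<pi>) * ?P a b else 0)"
    proof (intro sum.cong refl)
      fix a b assume "a \<in> ?I" "b \<in> ?I"
      then have "Const (T a b) * ?P a b
        = (\<Sum>\<pi> | \<pi> permutes {..<d}. Const (\<gamma> \<pi> * (if b = a \<circ> \<pi> then 1 else 0)) * ?P a b)"
        by (simp only: \<gamma> Const_sum sum_distrib_right)
      also have "\<dots> = (\<Sum>\<pi> | \<pi> permutes {..<d}. if b = a \<circ> \<pi> then Const (\<gamma> \<pi>) * ?P a b else 0)"
        by (simp only: Const_mult_indicator)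
      finally show "Const (T a b) * ?P a b
        = (\<Sum>\<pi> | \<pi> permutes {..<d}. if b = a \<circ> \<pi> then Const (\<gamma> \<pi>) * ?P a b else 0)" .
    qed
    also have "\<dots> = (\<Sum>a\<in>?I. \<Sum>\<pi> | \<pi> permutes {..<d}. \<Sum>b\<in>?I. if b = a \<circ> \<pi> then Const (\<gamma> \<pi>) * ?P a b else 0)"
      by (intro sum.cong refl sum.swap)
    \<comment> \<open>A permutation operator ties the column indices to the row indices by
      \<open>b = a \<circ> \<pi>\<close>; the remaining sum over \<open>a\<close> is a permuted
      trace of generic matrices.\<close>
    also have "\<dots> = (\<Sum>a\<in>?I. \<Sum>\<pi> | \<pi> permutes {..<d}. Const (\<gamma> \<pi>) * ?P a (a \<circ> \<pi>))"
    proof (intro sum.cong refl)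
      fix a \<pi> assume "a \<in> ?I" "\<pi> \<in> {\<pi>. \<pi> permutes {..<d}}"
      then have "a \<circ> \<pi> \<in> ?I"
        by (intro comp_permutes_in_PiE) auto
      then show "(\<Sum>b\<in>?I. if b = a \<circ> \<pi> then Const (\<gamma> \<pi>) * ?P a b else 0) = Const (\<gamma> \<pi>) * ?P a (a \<circ> \<pi>)"
        using finI by simp
    qed
    also have "\<dots> = (\<Sum>\<pi> | \<pi> permutes {..<d}. \<Sum>a\<in>?I. Const (\<gamma> \<pi>) * ?P a (a \<circ> \<pi>))"
      by (rule sum.swap)
    also have "\<dots> = (\<Sum>\<pi> | \<pi> permutes {..<d}. Const (\<gamma> \<pi>) *
        permuted_trace {..<d} \<pi> (\<lambda>s. generic_matrix (ks s)))"
      by (simp add: permuted_trace_def generic_matrix_def sum_distrib_left)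
    also have "\<dots> \<in> trace_span"
      by (intro trace_span_sum Const_mult_permuted_trace_in_trace_span) auto
    finally show ?thesis
      by (simp only: T_def)
  qed
  then have "tensor_poly D w \<in> trace_span"
    unfolding tensor_poly_def sum_tensor_indices fst_conv snd_conv
    by (subst sum_PiE_triples) (rule trace_span_sum, rule trace_span_sum, simp)
  then show ?thesis
    using f by blast
qed

section \<open>Mixed discriminants\<close>

text \<open>Left unnormalised, as n! need not be invertible in the ring: n equal arguments give n!
  times the determinant.\<close>

definition mixed_discriminant :: "('n \<Rightarrow> 'r::comm_ring_1 ^ 'n ^ 'n) \<Rightarrow> 'r"
  where "mixed_discriminant M = (\<Sum>\<sigma> | \<sigma> permutes UNIV. \<Sum>\<tau> | \<tau> permutes UNIV.
    of_int (sign \<sigma> * sign \<tau>) * (\<Prod>j\<in>UNIV. M j $ \<sigma> j $ \<tau> j))"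

text \<open>For fixed \<tau> the sum over \<sigma> is the determinant of a matrix whose column
  \<open>j\<close> is column \<open>\<tau> j\<close> of \<open>M j\<close>. Multiplying arguments on
  the left acts on its columns, which carries determinant identities over.\<close>

lemma mixed_discriminant_eq_sum_det:
  "mixed_discriminant M = (\<Sum>\<tau> | \<tau> permutes UNIV. of_int (sign \<tau>) * det (\<chi> i j. M j $ i $ \<tau> j))"
proof -
  have "det (\<chi> i j. M j $ i $ \<tau> j) = (\<Sum>\<sigma> | \<sigma> permutes UNIV. of_int (sign \<sigma>) * (\<Prod>j\<in>UNIV. M j $ \<sigma> j $ \<tau> j))" for \<tau>
    by (subst det_transpose[symmetric]) (simp add: det_def transpose_def)
  then show ?thesis
    unfolding mixed_discriminant_def
    by (subst sum.swap) (simp add: sum_distrib_left mult_ac)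
qed

lemma mixed_discriminant_transpose:
  "mixed_discriminant (\<lambda>j. Finite_Cartesian_Product.transpose (M j)) = mixed_discriminant M"
  unfolding mixed_discriminant_def
  by (subst sum.swap) (simp add: transpose_def mult.commute)

lemma mixed_discriminant_mult_left:
  "mixed_discriminant (\<lambda>j. A ** M j) = det A * mixed_discriminant M"
proof -
  have "(\<chi> i j. (A ** M j) $ i $ \<tau> j) = A ** (\<chi> i j. M j $ i $ \<tau> j)" for \<tau>
    by (simp add: vec_eq_iff matrix_mult_nth)
  then show ?thesis
    by (simp add: mixed_discriminant_eq_sum_det det_mul sum_distrib_left mult_ac)
qed

lemma mixed_discriminant_mult_right:
  "mixed_discriminant (\<lambda>j. M j ** A) = mixed_discriminant M * det A"
proof -
  have "mixed_discriminant (\<lambda>j. M j ** A)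
    = mixed_discriminant (\<lambda>j. Finite_Cartesian_Product.transpose A ** Finite_Cartesian_Product.transpose (M j))"
    by (simp add: mixed_discriminant_transpose flip: matrix_transpose_mul)
  then show ?thesis
    by (simp add: mixed_discriminant_mult_left mixed_discriminant_transpose mult.commute)
qed

lemma mixed_discriminant_mat1:
  "mixed_discriminant (\<lambda>_. mat 1 :: 'r::comm_ring_1 ^ 'n ^ 'n) = of_nat (fact CARD('n))"
proof -
  have "(\<Prod>j\<in>UNIV. (mat 1 :: 'r ^ 'n ^ 'n) $ \<sigma> j $ \<tau> j) = (if \<tau> = \<sigma> then 1 else 0)" for \<sigma> \<tau> :: "'n \<Rightarrow> 'n"
  proof (cases "\<tau> = \<sigma>")
    case False
    then obtain j where "\<sigma> j \<noteq> \<tau> j"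
      by (metis ext)
    then show ?thesis
      using False by (auto simp: mat_def intro!: prod_zero)
  qed (simp add: mat_def)
  then have "mixed_discriminant (\<lambda>_. mat 1 :: 'r ^ 'n ^ 'n)
    = (\<Sum>\<sigma> | \<sigma> permutes (UNIV :: 'n set). \<Sum>\<tau> | \<tau> permutes UNIV. if \<tau> = \<sigma> then 1 else 0)"
    unfolding mixed_discriminant_def by (intro sum.cong refl) (auto simp: sign_def)
  also have "\<dots> = of_nat (card {\<sigma>. \<sigma> permutes (UNIV :: 'n set)})"
    by (simp add: finite_permutations)
  finally show ?thesis
    by (simp add: card_permutations[OF refl finite_class.finite_UNIV])
qed

text \<open>Replacing row \<open>q\<close> of \<open>N\<close> by row \<open>l\<close> gives two equal rows unless \<open>l = q\<close>.\<close>

lemma sum_det_mult_column: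
  fixes N B :: "'r::comm_ring_1 ^ 'n ^ 'n"
  shows "(\<Sum>j\<in>UNIV. det (\<chi> i c. if c = j then (B ** N) $ i $ c else N $ i $ c)) = trace B * det N"
proof -
  let ?R = "\<lambda>q l. (\<chi> i c. if i = q then N $ l $ c else N $ i $ c)"
  have det_col: "det M = (\<Sum>\<sigma> | \<sigma> permutes UNIV. of_int (sign \<sigma>) * (\<Prod>c\<in>UNIV. M $ \<sigma> c $ c))"
    for M :: "'r ^ 'n ^ 'n"
    by (subst det_transpose[symmetric]) (simp add: det_def transpose_def)
  \<comment> \<open>In one term of the determinant, column \<open>j\<close> meets only row
    \<open>\<sigma> j\<close>. Changing that column therefore has the same effect as changing that
    row, which after expanding \<open>B ** N\<close> becomes row \<open>l\<close> of
    \<open>N\<close>.\<close>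
  have factor: "(\<Prod>c\<in>UNIV. if c = j then (B ** N) $ \<sigma> c $ c else N $ \<sigma> c $ c)
      = (\<Sum>l\<in>UNIV. B $ \<sigma> j $ l * (\<Prod>c\<in>UNIV. ?R (\<sigma> j) l $ \<sigma> c $ c))"
    if "\<sigma> permutes UNIV" for \<sigma> :: "'n \<Rightarrow> 'n" and j
  proof -
    have inj: "\<sigma> c = \<sigma> j \<longleftrightarrow> c = j" for c
      using permutes_inj[OF that] by (auto dest: injD)
    let ?Q = "\<Prod>c\<in>UNIV - {j}. N $ \<sigma> c $ c"
    have "(\<Prod>c\<in>UNIV. if c = j then (B ** N) $ \<sigma> c $ c else N $ \<sigma> c $ c) = (B ** N) $ \<sigma> j $ j * ?Q"
      by (subst prod.remove[of _ j]) (auto intro!: arg_cong[of _ _ "(*) _"] prod.cong)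
    moreover have "(\<Prod>c\<in>UNIV. ?R (\<sigma> j) l $ \<sigma> c $ c) = N $ l $ j * ?Q" for l
      by (subst prod.remove[of _ j]) (auto simp: inj intro!: arg_cong[of _ _ "(*) _"] prod.cong)
    ultimately show ?thesis
      by (simp add: matrix_mult_nth sum_distrib_right mult.assoc)
  qed
  have "(\<Sum>j\<in>UNIV. det (\<chi> i c. if c = j then (B ** N) $ i $ c else N $ i $ c))
    = (\<Sum>j\<in>UNIV. \<Sum>\<sigma> | \<sigma> permutes UNIV. \<Sum>l\<in>UNIV. of_int (sign \<sigma>) *
        (B $ \<sigma> j $ l * (\<Prod>c\<in>UNIV. ?R (\<sigma> j) l $ \<sigma> c $ c)))"
    by (simp add: det_col factor sum_distrib_left)
  also have "\<dots> = (\<Sum>\<sigma> | \<sigma> permutes UNIV. \<Sum>j\<in>UNIV. \<Sum>l\<in>UNIV. of_int (sign \<sigma>) *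
        (B $ \<sigma> j $ l * (\<Prod>c\<in>UNIV. ?R (\<sigma> j) l $ \<sigma> c $ c)))"
    by (rule sum.swap)
  \<comment> \<open>Substituting \<open>q = \<sigma> j\<close> makes the replaced row independent of
    \<sigma>, so that the sum over \<sigma> becomes a determinant.\<close>
  also have "\<dots> = (\<Sum>\<sigma> | \<sigma> permutes UNIV. \<Sum>q\<in>UNIV. \<Sum>l\<in>UNIV. of_int (sign \<sigma>) *
        (B $ q $ l * (\<Prod>c\<in>UNIV. ?R q l $ \<sigma> c $ c)))"
  proof (rule sum.cong[OF refl])
    fix \<sigma> :: "'n \<Rightarrow> 'n" assume "\<sigma> \<in> {\<sigma>. \<sigma> permutes UNIV}"
    then have "bij \<sigma>" by (simp add: permutes_bij)
    then show "(\<Sum>j\<in>UNIV. \<Sum>l\<in>UNIV. of_int (sign \<sigma>) * (B $ \<sigma> j $ l * (\<Prod>c\<in>UNIV. ?R (\<sigma> j) l $ \<sigma> c $ c)))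
      = (\<Sum>q\<in>UNIV. \<Sum>l\<in>UNIV. of_int (sign \<sigma>) * (B $ q $ l * (\<Prod>c\<in>UNIV. ?R q l $ \<sigma> c $ c)))"
      by (rule sum.reindex_bij_betw[of \<sigma> UNIV UNIV "\<lambda>q. \<Sum>l\<in>UNIV. of_int (sign \<sigma>) *
          (B $ q $ l * (\<Prod>c\<in>UNIV. ?R q l $ \<sigma> c $ c))"])
  qed
  also have "\<dots> = (\<Sum>q\<in>UNIV. \<Sum>\<sigma> | \<sigma> permutes UNIV. \<Sum>l\<in>UNIV. of_int (sign \<sigma>) *
        (B $ q $ l * (\<Prod>c\<in>UNIV. ?R q l $ \<sigma> c $ c)))"
    by (rule sum.swap)
  also have "\<dots> = (\<Sum>q\<in>UNIV. \<Sum>l\<in>UNIV. \<Sum>\<sigma> | \<sigma> permutes UNIV. of_int (sign \<sigma>) *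
        (B $ q $ l * (\<Prod>c\<in>UNIV. ?R q l $ \<sigma> c $ c)))"
    by (intro sum.cong refl sum.swap)
  also have "\<dots> = (\<Sum>q\<in>UNIV. \<Sum>l\<in>UNIV. B $ q $ l * det (?R q l))"
    unfolding det_col sum_distrib_left by (intro sum.cong refl) (rule mult.left_commute)
  also have "\<dots> = (\<Sum>q\<in>UNIV. \<Sum>l\<in>UNIV. if l = q then B $ q $ q * det N else 0)"
  proof (intro sum.cong refl)
    fix q l :: 'n
    show "B $ q $ l * det (?R q l) = (if l = q then B $ q $ q * det N else 0)"
    proof (cases "l = q")
      case True
      have "?R q q = N" by (simp add: vec_eq_iff)
      then show ?thesis unfolding True by simp
    next
      case False
      have "det (?R q l) = 0"
        by (rule det_identical_rows[OF False]) (use False in \<open>simp add: row_def vec_eq_iff\<close>)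
      then show ?thesis using False by simp
    qed
  qed
  also have "\<dots> = trace B * det N"
    by (simp add: trace_def sum_distrib_right)
  finally show ?thesis .
qed

text \<open>For each \<tau>, multiplying the argument \<open>M j\<close> by \<open>B\<close>
  multiplies column \<open>j\<close> of the auxiliary matrix by \<open>B\<close>, so
  \<open>sum_det_mult_column\<close> applies term by term.\<close>

lemma sum_mixed_discriminant_mult:
  "(\<Sum>j\<in>UNIV. mixed_discriminant (M(j := B ** M j))) = trace B * mixed_discriminant M"
proof -
  have eq: "(\<chi> i c. (M(j := B ** M j)) c $ i $ \<tau> c)
      = (\<chi> i c. if c = j then (B ** (\<chi> i c. M c $ i $ \<tau> c)) $ i $ c else (\<chi> i c. M c $ i $ \<tau> c) $ i $ c)"
    for j and \<tau> :: "'b \<Rightarrow> 'b"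
    by (simp add: vec_eq_iff matrix_mult_nth)
  have "(\<Sum>j\<in>UNIV. mixed_discriminant (M(j := B ** M j)))
    = (\<Sum>\<tau> | \<tau> permutes UNIV. of_int (sign \<tau>) * (trace B * det (\<chi> i c. M c $ i $ \<tau> c)))"
    unfolding mixed_discriminant_eq_sum_det eq
    by (subst sum.swap) (simp only: sum_distrib_left[symmetric] sum_det_mult_column)
  then show ?thesis
    by (simp add: mixed_discriminant_eq_sum_det sum_distrib_left mult.left_commute)
qed

section \<open>Words in the generic matrices modulo the commutators\<close>

definition matrix_cong :: "('m::finite, 'n::finite) rep_poly ^ 'n ^ 'n \<Rightarrow> ('m, 'n) rep_poly ^ 'n ^ 'n \<Rightarrow> bool"
  where "matrix_cong A B \<longleftrightarrow> (\<forall>i j. A $ i $ j - B $ i $ j \<in> comm_ideal)"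

lemma matrix_cong_refl: "matrix_cong A A"
  by (simp add: matrix_cong_def ideal_zero[OF ideal_comm_ideal])

lemma matrix_cong_trans: "matrix_cong A B \<Longrightarrow> matrix_cong B C \<Longrightarrow> matrix_cong A C"
  unfolding matrix_cong_def using ideal_trans[OF ideal_comm_ideal] by blast

lemma matrix_cong_mult: "matrix_cong A A' \<Longrightarrow> matrix_cong B B' \<Longrightarrow> matrix_cong (A ** B) (A' ** B')"
  unfolding matrix_cong_def matrix_mult_nth
  by (intro allI ideal_sum_cong[OF ideal_comm_ideal] ideal_mult_cong[OF ideal_comm_ideal]) auto

lemma mixed_discriminant_cong:
  assumes "\<And>j. matrix_cong (M j) (M' j)"
  shows "mixed_discriminant M - mixed_discriminant M' \<in> comm_ideal"
proof -
  note J = ideal_comm_ideal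
  have "(\<Prod>j\<in>UNIV. M j $ \<sigma> j $ \<tau> j) - (\<Prod>j\<in>UNIV. M' j $ \<sigma> j $ \<tau> j) \<in> comm_ideal" for \<sigma> \<tau>
    using assms by (intro ideal_prod_cong[OF J]) (simp add: matrix_cong_def)
  then show ?thesis
    unfolding mixed_discriminant_def
    by (intro ideal_sum_cong[OF J]) (simp add: ideal_mult_left[OF J] flip: right_diff_distrib)
qed

lemma word_matrix_move:
  "matrix_cong (word_matrix (p @ k # w)) (word_matrix (k # p @ w) :: ('m::finite, 'n::finite) rep_poly ^ 'n ^ 'n)"
proof (induction p)
  case (Cons l p)
  have "matrix_cong (generic_matrix l ** word_matrix (p @ k # w)) (generic_matrix l ** word_matrix (k # p @ w) ::
      ('m, 'n) rep_poly ^ 'n ^ 'n)"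
    by (rule matrix_cong_mult[OF matrix_cong_refl Cons.IH])
  moreover have "matrix_cong (generic_matrix l ** generic_matrix k) (generic_matrix k ** generic_matrix l :: ('m, 'n) rep_poly ^ 'n ^ 'n)"
    unfolding matrix_cong_def vector_minus_component[symmetric] by (intro allI commutator_in_comm_ideal)
  then have "matrix_cong (generic_matrix l ** generic_matrix k ** word_matrix (p @ w))
      (generic_matrix k ** generic_matrix l ** word_matrix (p @ w) :: ('m, 'n) rep_poly ^ 'n ^ 'n)"
    by (rule matrix_cong_mult[OF _ matrix_cong_refl])
  ultimately show ?case
    by (simp add: matrix_mul_assoc) (rule matrix_cong_trans)
qed (simp add: matrix_cong_refl)

lemma word_matrix_cong:
  "mset u = mset w \<Longrightarrow>
    matrix_cong (word_matrix u) (word_matrix w :: ('m::finite, 'n::finite) rep_poly ^ 'n ^ 'n)"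
proof (induction u arbitrary: w)
  case Nil
  then show ?case by (simp add: matrix_cong_refl)
next
  case (Cons k u)
  then have "k \<in> set w"
    by (metis list.set_intros(1) set_mset_mset)
  then obtain p q where w: "w = p @ k # q"
    by (meson split_list)
  have "matrix_cong (word_matrix (k # u)) (word_matrix (k # p @ q) :: ('m, 'n) rep_poly ^ 'n ^ 'n)"
    using Cons.IH[of "p @ q"] Cons.prems matrix_cong_mult[OF matrix_cong_refl]
    by (simp add: w)
  moreover have "matrix_cong (word_matrix (k # p @ q)) (word_matrix w :: ('m, 'n) rep_poly ^ 'n ^ 'n)"
    using word_matrix_move[of p k q] ideal_sym[OF ideal_comm_ideal]
    unfolding w matrix_cong_def by blast
  ultimately show ?case
    by (rule matrix_cong_trans)
qed

section \<open>A section of the restriction to diagonal matrices\<close>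

text \<open>A word spelling the monomial in the variables with index \<open>j\<close>. Its order is
  an arbitrary choice, harmless by \<open>word_matrix_cong\<close> wherever congruence modulo the
  commutators is all that is claimed.\<close>

definition word_of :: "(('m::finite \<times> 'n) \<Rightarrow>\<^sub>0 nat) \<Rightarrow> 'n \<Rightarrow> 'm list"
  where "word_of a j = (SOME w. mset w = (\<Sum>k\<in>UNIV. replicate_mset (Poly_Mapping.lookup a (k, j)) k))"

lemma count_mset_word_of: "count (mset (word_of a j)) k = Poly_Mapping.lookup a (k, j)"
proof -
  have "mset (word_of a j) = (\<Sum>k\<in>UNIV. replicate_mset (Poly_Mapping.lookup a (k, j)) k)"
    unfolding word_of_def by (rule someI_ex[OF ex_mset])
  then show ?thesis
    by (simp add: count_sum)
qed

lemma prod_list_map_eq_prod_count: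
  fixes f :: "'m::finite \<Rightarrow> 'r::comm_monoid_mult"
  shows "(\<Prod>k\<leftarrow>w. f k) = (\<Prod>k\<in>UNIV. f k ^ count (mset w) k)"
proof (induction w)
  case (Cons l w)
  have "(\<Prod>k\<in>UNIV. f k ^ count (mset (l # w)) k)
    = (\<Prod>k\<in>UNIV. (if k = l then f l else 1) * f k ^ count (mset w) k)"
    by (intro prod.cong) auto
  then show ?case
    by (simp add: prod.distrib Cons.IH)
qed simp

definition trace_section :: "('m::finite, 'n::finite) diag_poly \<Rightarrow> ('m, 'n) rep_poly"
  where "trace_section = linear_extension
    (\<lambda>a. Const (1 / fact CARD('n)) * mixed_discriminant (\<lambda>j. word_matrix (word_of a j)))"

lemma trace_section_add: "trace_section (p + q) = trace_section p + trace_section q"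
  and trace_section_sum: "trace_section (sum F A) = (\<Sum>x\<in>A. trace_section (F x))"
  and trace_section_Const_mult: "trace_section (Const c * p) = Const c * trace_section p"
  by (simp_all add: trace_section_def linear_extension_add linear_extension_sum
      linear_extension_Const_mult)

lemma trace_section_single:
  "trace_section (Poly_Mapping.single a c :: ('m::finite, 'n::finite) diag_poly) =
    Const c * (Const (1 / fact CARD('n)) * mixed_discriminant (\<lambda>j. word_matrix (word_of a j)))"
  by (simp add: trace_section_def linear_extension_single)

text \<open>This fixes the normalisation: all words are empty, and n identity matrices have mixed
  discriminant n!.\<close>

lemma trace_section_1: "trace_section (1 :: ('m::finite, 'n::finite) diag_poly) = 1"
proof -
  have "word_of (0 :: ('m \<times> 'n) \<Rightarrow>\<^sub>0 nat) j = []" for j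
  proof -
    have "mset (word_of (0 :: ('m \<times> 'n) \<Rightarrow>\<^sub>0 nat) j) = {#}"
      by (rule multiset_eqI) (simp add: count_mset_word_of)
    then show ?thesis by simp
  qed
  moreover have "Const (1 / fact CARD('n)) * of_nat (fact CARD('n)) = (1 :: ('m, 'n) rep_poly)"
    by (simp add: Const_of_nat[symmetric] Const_mult[symmetric])
  ultimately show ?thesis
    using trace_section_single[of "0 :: ('m \<times> 'n) \<Rightarrow>\<^sub>0 nat" 1]
    by (simp add: mixed_discriminant_mat1)
qed

definition word_exponent :: "'m list \<Rightarrow> 'n \<Rightarrow> ('m \<times> 'n) \<Rightarrow>\<^sub>0 nat"
  where "word_exponent w j = (\<Sum>k\<leftarrow>w. Poly_Mapping.single (k, j) 1)"

lemma lookup_word_exponent: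
  "Poly_Mapping.lookup (word_exponent w j) (k, i) = (if i = j then count (mset w) k else 0)"
  by (induction w) (auto simp: word_exponent_def lookup_add lookup_single when_def)

lemma prod_list_Var_eq_single:
  "(\<Prod>k\<leftarrow>w. Var (k, j)) = Poly_Mapping.single (word_exponent w j) 1"
  by (induction w) (simp_all add: word_exponent_def Var_def mult_single)

text \<open>The summand for \<open>j\<close> multiplies a monomial by letters with index
  \<open>j\<close> only, which up to order prepends \<open>w\<close> to the word in argument
  \<open>j\<close>. Summing over \<open>j\<close> is the trace identity for mixed discriminants with
  \<open>B\<close> the matrix of \<open>w\<close>.\<close>

lemma trace_section_power_sum_mult:
  fixes h :: "('m::finite, 'n::finite) diag_poly"
  shows "trace_section ((\<Sum>j\<in>UNIV. \<Prod>k\<leftarrow>w. Var (k, j)) * h) - trace (word_matrix w) * trace_section h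
    \<in> comm_ideal"
proof (induction h rule: cpoly_induct)
  case (single a c)
  note J = ideal_comm_ideal
  let ?M = "\<lambda>j. word_matrix (word_of a j) :: ('m, 'n) rep_poly ^ 'n ^ 'n"
  let ?N = "\<lambda>j i. word_matrix (word_of (word_exponent w j + a) i) :: ('m, 'n) rep_poly ^ 'n ^ 'n"
  let ?f = "Const (1 / fact CARD('n)) :: ('m, 'n) rep_poly"
  have "matrix_cong (?N j i) ((?M(j := word_matrix w ** ?M j)) i)" for i j
  proof -
    have "mset (word_of (word_exponent w j + a) i) = mset (if i = j then w @ word_of a i else word_of a i)"
      by (rule multiset_eqI) (auto simp: count_mset_word_of lookup_add lookup_word_exponent)
    then have "matrix_cong (?N j i) (word_matrix (if i = j then w @ word_of a i else word_of a i))"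
      by (rule word_matrix_cong)
    also have "word_matrix (if i = j then w @ word_of a i else word_of a i)
        = (?M(j := word_matrix w ** ?M j)) i"
      by (simp add: word_matrix_append)
    finally show ?thesis .
  qed
  then have MD: "mixed_discriminant (?N j) - mixed_discriminant (?M(j := word_matrix w ** ?M j)) \<in> comm_ideal" for j
    by (rule mixed_discriminant_cong)
  have "trace_section ((\<Sum>j\<in>UNIV. \<Prod>k\<leftarrow>w. Var (k, j)) * Poly_Mapping.single a c)
    = Const c * (?f * (\<Sum>j\<in>UNIV. mixed_discriminant (?N j)))"
    by (simp add: prod_list_Var_eq_single sum_distrib_right mult_single trace_section_sum
        trace_section_single sum_distrib_left)
  moreover have "trace (word_matrix w) * trace_section (Poly_Mapping.single a c)
    = Const c * (?f * (\<Sum>j\<in>UNIV. mixed_discriminant (?M(j := word_matrix w ** ?M j))))"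
    by (simp add: sum_mixed_discriminant_mult trace_section_single mult_ac)
  ultimately show ?case
    using ideal_mult_left[OF J, of _ "Const c * ?f", OF ideal_sum_cong[OF J, OF MD]]
    by (simp add: right_diff_distrib mult.assoc)
next
  case (add p q)
  then show ?case
    using ideal_add[OF ideal_comm_ideal add.IH]
    by (simp add: distrib_left trace_section_add algebra_simps)
qed

lemma diag_subst_hom:
  shows diag_subst_0: "diag_subst 0 = 0"
    and diag_subst_1: "diag_subst 1 = 1"
    and diag_subst_add: "diag_subst (p + q) = diag_subst p + diag_subst q"
    and diag_subst_diff: "diag_subst (p - q) = diag_subst p - diag_subst q"
    and diag_subst_mult: "diag_subst (p * q) = diag_subst p * diag_subst q"
    and diag_subst_power: "diag_subst (p ^ k) = diag_subst p ^ k"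
    and diag_subst_sum: "diag_subst (sum F A) = (\<Sum>x\<in>A. diag_subst (F x))"
    and diag_subst_prod: "diag_subst (prod F A) = (\<Prod>x\<in>A. diag_subst (F x))"
    and diag_subst_Const: "diag_subst (Const c) = Const c"
    and diag_subst_of_int: "diag_subst (of_int n) = of_int n"
  by (simp_all add: diag_subst_def subst_add subst_diff subst_mult subst_power subst_sum subst_prod)

lemma diag_subst_generic_matrix:
  "diag_subst (generic_matrix k $ i $ j) = (if i = j then Var (k, i) else 0)"
  by (simp add: generic_matrix_def diag_subst_def)

lemma diag_subst_word_matrix:
  "diag_subst (word_matrix w $ i $ j) = (if i = j then \<Prod>k\<leftarrow>w. Var (k, i) else 0)"
proof (induction w arbitrary: i j)
  case Nil
  then show ?case by (simp add: mat_def diag_subst_0 diag_subst_1)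
next
  case (Cons k w)
  have "diag_subst (word_matrix (k # w) $ i $ j)
    = (\<Sum>l\<in>UNIV. (if i = l then Var (k, i) else 0) * diag_subst (word_matrix w $ l $ j))"
    by (simp only: word_matrix.simps matrix_mult_nth diag_subst_sum diag_subst_mult
        diag_subst_generic_matrix)
  also have "\<dots> = (\<Sum>l\<in>UNIV. if l = i then Var (k, i) * diag_subst (word_matrix w $ l $ j) else 0)"
    by (intro sum.cong) auto
  also have "\<dots> = Var (k, i) * diag_subst (word_matrix w $ i $ j)"
    by simp
  finally show ?case by (simp add: Cons.IH)
qed

lemma diag_subst_trace_word_matrix:
  "diag_subst (trace (word_matrix w)) = (\<Sum>j\<in>UNIV. \<Prod>k\<leftarrow>w. Var (k, j))"
  by (simp add: trace_def diag_subst_sum diag_subst_word_matrix)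

lemma diag_subst_comm_ideal:
  fixes p :: "('m::finite, 'n::finite) rep_poly"
  assumes "p \<in> comm_ideal"
  shows "diag_subst p = 0"
proof -
  have "ideal {0 :: ('m, 'n) diag_poly} ring_of_type_algebra"
    by (rule ideal_ring_of_type_algebraI) auto
  moreover have "diag_subst s \<in> {0}" if "s \<in> commutator_entries" for s :: "('m, 'n) rep_poly"
  proof -
    obtain k l i j
      where "s = (generic_matrix k ** generic_matrix l - generic_matrix l ** generic_matrix k) $ i $ j"
      using \<open>s \<in> commutator_entries\<close> unfolding commutator_entries_def by blast
    then have "s = word_matrix [k, l] $ i $ j - word_matrix [l, k] $ i $ j"
      by simp
    then show ?thesis
      by (simp only: diag_subst_diff diag_subst_word_matrix) (simp add: mult.commute)
  qed
  ultimately have "diag_subst p \<in> {0}"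
    using assms unfolding comm_ideal_def diag_subst_def by (rule subst_genideal)
  then show ?thesis by simp
qed

text \<open>Traces of words restrict to power sums, and the section turns these back into traces one
  factor at a time, starting from 1. Multiplicativity of the section is never claimed.\<close>

lemma trace_section_diag_subst:
  fixes p :: "('m::finite, 'n::finite) rep_poly"
  assumes "p \<in> trace_span"
  shows "trace_section (diag_subst p) - p \<in> comm_ideal"
  using assms
proof induction
  case (gen c ws)
  note J = ideal_comm_ideal
  have "trace_section (diag_subst (\<Prod>w\<leftarrow>ws. trace (word_matrix w))) -
      (\<Prod>w\<leftarrow>ws. trace (word_matrix w)) \<in> (comm_ideal :: ('m, 'n) rep_poly set)"
  proof (induction ws)
    case Nil
    then show ?case by (simp add: diag_subst_1 trace_section_1 ideal_zero[OF J])
  next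
    case (Cons w ws)
    let ?P = "\<Prod>w\<leftarrow>ws. trace (word_matrix w) :: ('m, 'n) rep_poly"
    have "trace_section (diag_subst (trace (word_matrix w) * ?P))
        - trace (word_matrix w) * trace_section (diag_subst ?P) \<in> comm_ideal"
      by (simp only: diag_subst_mult diag_subst_trace_word_matrix trace_section_power_sum_mult)
    moreover have "trace (word_matrix w) * trace_section (diag_subst ?P) - trace (word_matrix w) * ?P \<in> comm_ideal"
      using ideal_mult_left[OF J Cons.IH] by (simp add: right_diff_distrib)
    ultimately show ?case
      using ideal_trans[OF J] by simp
  qed
  from ideal_mult_left[OF J this, of "Const c"] show ?case
    by (simp add: diag_subst_mult diag_subst_Const trace_section_Const_mult right_diff_distrib)
next
  case (add p q)
  then show ?case
    using ideal_add[OF ideal_comm_ideal add.IH] by (simp add: diag_subst_add trace_section_add algebra_simps)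
qed

text \<open>On diagonal matrices only the terms with \<tau> = \<sigma> of the mixed discriminant
  survive, with sign 1. Thus restriction after the section is exactly the Reynolds operator of the
  symmetric group.\<close>

lemma diag_subst_trace_section:
  fixes h :: "('m::finite, 'n::finite) diag_poly"
  shows "diag_subst (trace_section h) =
    Const (1 / fact CARD('n)) * (\<Sum>\<sigma> | \<sigma> permutes UNIV. Sn_act \<sigma> h)"
proof (induction h rule: cpoly_induct)
  case (single a c)
  let ?x = "\<lambda>\<sigma> j. \<Prod>k\<leftarrow>word_of a j. Var (k, \<sigma> j) :: ('m, 'n) diag_poly"
  have Sn: "Sn_act \<sigma> (Poly_Mapping.single a c) = Const c * (\<Prod>j\<in>UNIV. ?x \<sigma> j)" for \<sigma>
  proof -
    have "?x \<sigma> j = (\<Prod>k\<in>UNIV. Var (k, \<sigma> j) ^ Poly_Mapping.lookup a (k, j))" for j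
      by (simp add: prod_list_map_eq_prod_count count_mset_word_of)
    then have "(\<Prod>j\<in>UNIV. ?x \<sigma> j) = (\<Prod>k\<in>UNIV. \<Prod>j\<in>UNIV. Var (k, \<sigma> j) ^ Poly_Mapping.lookup a (k, j))"
      by (simp add: prod.swap[of _ _ "UNIV :: 'n set"])
    also have "\<dots> = monomial_value (\<lambda>(k, j). Var (k, \<sigma> j)) a"
      by (simp add: monomial_value_superset[of UNIV] prod.cartesian_product case_prod_unfold)
    finally show ?thesis
      by (simp add: Sn_act_def subst_single)
  qed
  have "diag_subst (mixed_discriminant (\<lambda>j. word_matrix (word_of a j) :: ('m, 'n) rep_poly ^ 'n ^ 'n))
    = (\<Sum>\<sigma> | \<sigma> permutes UNIV. \<Sum>\<tau> | \<tau> permutes UNIV. if \<tau> = \<sigma> then \<Prod>j\<in>UNIV. ?x \<sigma> j else 0)"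
  proof -
    have "(\<Prod>j\<in>UNIV. if \<sigma> j = \<tau> j then ?x \<sigma> j else 0) = (if \<tau> = \<sigma> then \<Prod>j\<in>UNIV. ?x \<sigma> j else 0)"
      for \<sigma> \<tau> :: "'n \<Rightarrow> 'n"
    proof (cases "\<tau> = \<sigma>")
      case False
      then obtain j where "\<sigma> j \<noteq> \<tau> j"
        by (metis ext)
      then show ?thesis
        using False by (auto intro!: prod_zero)
    qed simp
    then have "diag_subst (mixed_discriminant (\<lambda>j. word_matrix (word_of a j) :: ('m, 'n) rep_poly ^ 'n ^ 'n))
      = (\<Sum>\<sigma> | \<sigma> permutes UNIV. \<Sum>\<tau> | \<tau> permutes UNIV. of_int (sign \<sigma> * sign \<tau>) *
          (if \<tau> = \<sigma> then \<Prod>j\<in>UNIV. ?x \<sigma> j else 0))"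
      by (simp only: mixed_discriminant_def diag_subst_sum diag_subst_mult diag_subst_prod
          diag_subst_of_int diag_subst_word_matrix)
    also have "\<dots> = (\<Sum>\<sigma> | \<sigma> permutes UNIV. \<Sum>\<tau> | \<tau> permutes UNIV.
        if \<tau> = \<sigma> then \<Prod>j\<in>UNIV. ?x \<sigma> j else 0)"
      by (intro sum.cong refl) (simp add: sign_def)
    finally show ?thesis .
  qed
  also have "\<dots> = (\<Sum>\<sigma> | \<sigma> permutes UNIV. \<Prod>j\<in>UNIV. ?x \<sigma> j)"
    by (simp add: finite_permutations)
  finally show ?case
    by (simp add: trace_section_single diag_subst_mult diag_subst_Const Sn sum_distrib_left mult_ac)
next
  case (add p q)
  then show ?case
    by (simp add: trace_section_add diag_subst_add Sn_act_def subst_add sum.distrib distrib_left)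
qed

text \<open>Holds exactly and not just modulo the commutators: conjugating all arguments multiplies
  the mixed discriminant by the determinants of \<open>g\<close> and its inverse.\<close>

lemma GL_act_trace_section:
  fixes g :: "complex ^ 'n ^ 'n" and h :: "('m::finite, 'n::finite) diag_poly"
  assumes g: "invertible g"
  shows "GL_act g (trace_section h) = trace_section h"
proof (induction h rule: cpoly_induct)
  case (single a c)
  let ?M = "\<lambda>j. word_matrix (word_of a j) :: ('m, 'n) rep_poly ^ 'n ^ 'n"
  let ?g = "map_matrix Const g :: ('m, 'n) rep_poly ^ 'n ^ 'n"
  let ?h = "map_matrix Const (matrix_inv g) :: ('m, 'n) rep_poly ^ 'n ^ 'n"
  have "GL_act g (mixed_discriminant ?M) = mixed_discriminant (\<lambda>j. map_matrix (GL_act g) (?M j))"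
    by (simp add: mixed_discriminant_def GL_act_sum GL_act_mult GL_act_prod GL_act_of_int
        del: of_int_mult)
  also have "\<dots> = mixed_discriminant (\<lambda>j. ?h ** ?M j ** ?g)"
    by (simp only: GL_act_word_matrix[OF g] conjugate_def)
  also have "\<dots> = det ?h * det ?g * mixed_discriminant ?M"
    by (simp only: mixed_discriminant_mult_right mixed_discriminant_mult_left mult_ac)
  also have "det ?h * det ?g = 1"
    by (simp only: det_mul[symmetric] map_matrix_Const_inv[OF g] det_I)
  finally show ?case
    by (simp add: trace_section_single GL_act_mult GL_act_Const)
qed (simp add: trace_section_add GL_act_add)

section \<open>The isomorphism\<close>

text \<open>Renaming the variables injectively by natural numbers gives ordered exponent vectors,
  for which the polynomial ring is known to be a domain.\<close>

lemma cpoly_power_eq_0: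
  fixes f :: "'v::finite cpoly"
  assumes "f ^ k = 0"
  shows "f = 0"
proof -
  obtain \<iota> :: "'v \<Rightarrow> nat" where \<iota>: "inj \<iota>"
    using finite_imp_inj_to_nat_seg[of "UNIV :: 'v set"] by auto
  have "subst (\<lambda>v. Var (\<iota> v)) f ^ k = 0"
    using assms by (simp flip: subst_power)
  then have "subst (\<lambda>v. Var (\<iota> v)) f = 0"
    by (simp only: power_eq_0_iff)
  then have "subst (\<lambda>v. Var (inv \<iota> v)) (subst (\<lambda>v. Var (\<iota> v)) f) = 0"
    by simp
  then show ?thesis
    by (simp add: subst_subst inv_f_f[OF \<iota>])
qed

lemma ex_GL_realizing_permutation:
  fixes \<pi> :: "'n::finite \<Rightarrow> 'n"
  assumes \<pi>: "\<pi> permutes UNIV"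
  obtains g :: "complex ^ 'n ^ 'n"
  where "invertible g" "\<And>f :: ('m::finite, 'n) rep_poly. diag_subst (GL_act g f) = Sn_act \<pi> (diag_subst f)"
proof
  \<comment> \<open>Conjugation by this permutation matrix sends the \<open>(i, j)\<close> entry to
    the \<open>(\<pi> i, \<pi> j)\<close> entry, the direction that matches
    \<open>Sn_act\<close>.\<close>
  define g :: "complex ^ 'n ^ 'n" where "g = (\<chi> a b. if a = \<pi> b then 1 else 0)"
  define h :: "complex ^ 'n ^ 'n" where "h = (\<chi> a b. if b = \<pi> a then 1 else 0)"
  have inj: "\<pi> a = \<pi> b \<longleftrightarrow> a = b" for a b
    using permutes_inj[OF \<pi>] by (auto dest: injD)
  have hg: "h ** g = mat 1"
    by (simp add: vec_eq_iff matrix_mult_nth g_def h_def mat_def inj if_distrib[of "\<lambda>x. x * _"] cong: if_cong)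
  then have gh: "g ** h = mat 1"
    by (simp add: matrix_left_right_inverse)
  show "invertible g"
    by (rule matrix_inv_eqI[OF gh hg])
  have inv: "matrix_inv g = h"
    by (rule matrix_inv_eqI[OF gh hg])
  fix f :: "('m, 'n) rep_poly"
  have "diag_subst ((map_matrix Const h ** generic_matrix k ** map_matrix Const g) $ i $ j)
    = (if i = j then Var (k, \<pi> i) else 0)" for k :: 'm and i j :: 'n
  proof -
    have "diag_subst ((map_matrix Const h ** generic_matrix k ** map_matrix Const g) $ i $ j)
      = (\<Sum>b\<in>UNIV. \<Sum>a\<in>UNIV. Const (h $ i $ a) * (if a = b then Var (k, a) else 0) * Const (g $ b $ j))"
      by (simp only: matrix_mult_nth diag_subst_sum diag_subst_mult diag_subst_generic_matrix
          nth_map_matrix diag_subst_Const sum_distrib_right)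
    also have "\<dots> = (\<Sum>b\<in>UNIV. \<Sum>a\<in>UNIV. if a = \<pi> i then (if b = \<pi> i then if i = j then Var (k, \<pi> i) else 0 else 0) else 0)"
      by (intro sum.cong refl) (auto simp: g_def h_def inj)
    finally show ?thesis by simp
  qed
  then have "(\<lambda>v. diag_subst (case v of (k, i, j) \<Rightarrow>
        (map_matrix Const (matrix_inv g) ** generic_matrix k ** map_matrix Const g) $ i $ j))
    = (\<lambda>v. Sn_act \<pi> (case v of (k, i, j) \<Rightarrow> if i = j then Var (k, i) else 0) :: ('m, 'n) diag_poly)"
    by (auto simp: inv fun_eq_iff Sn_act_def)
  then show "diag_subst (GL_act g f) = Sn_act \<pi> (diag_subst f)"
    by (simp add: diag_subst_def GL_act_def Sn_act_def subst_subst)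
qed

text \<open>Invariance of a coset is an equality of sets, so the action must also be seen to map
  onto the image coset; the inverse matrix provides preimages.\<close>

lemma GL_act_matrix_inv:
  fixes g :: "complex ^ 'n ^ 'n" and f :: "('m::finite, 'n) rep_poly"
  assumes g: "invertible g"
  shows "GL_act g (GL_act (matrix_inv g) f) = f"
proof -
  let ?g = "map_matrix Const g :: ('m, 'n) rep_poly ^ 'n ^ 'n"
  let ?h = "map_matrix Const (matrix_inv g) :: ('m, 'n) rep_poly ^ 'n ^ 'n"
  have inv: "matrix_inv (matrix_inv g) = g"
    by (rule matrix_inv_eqI[OF matrix_inv_mult(2,1)[OF g]])
  have "map_matrix (GL_act g) (?g ** generic_matrix k ** ?h) = generic_matrix k" for k
  proof -
    have const: "map_matrix (GL_act g) (map_matrix Const x) = (map_matrix Const x :: ('m, 'n) rep_poly ^ 'n ^ 'n)" for x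
      by (simp add: vec_eq_iff GL_act_Const)
    have "map_matrix (GL_act g) (?g ** generic_matrix k ** ?h) = ?g ** conjugate g (generic_matrix k) ** ?h"
      by (simp only: map_matrix_subst_mult GL_act_def)
        (simp only: GL_act_def[symmetric] const map_matrix_GL_act_generic)
    also have "\<dots> = (?g ** ?h) ** generic_matrix k ** (?g ** ?h)"
      by (simp add: conjugate_def matrix_mul_assoc)
    finally show ?thesis
      by (simp add: map_matrix_Const_inv[OF g])
  qed
  then have eq: "GL_act g ((?g ** generic_matrix k ** ?h) $ i $ j) = Var (k, i, j)" for k i j
    by (metis (no_types, lifting) generic_matrix_def nth_map_matrix vec_lambda_beta)
  have "GL_act g (GL_act (matrix_inv g) f)
    = subst (\<lambda>v. GL_act g (case v of (k, i, j) \<Rightarrow> (?g ** generic_matrix k ** ?h) $ i $ j)) f"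
    unfolding GL_act_def subst_subst inv ..
  also have "(\<lambda>v. GL_act g (case v of (k, i, j) \<Rightarrow> (?g ** generic_matrix k ** ?h) $ i $ j)) = Var"
    by (auto simp: eq fun_eq_iff)
  finally show ?thesis by simp
qed

section \<open>The quotient ring, its invariants and their restrictions\<close>

definition rep_coset :: "('m::finite, 'n::finite) rep_poly \<Rightarrow> ('m, 'n) rep_poly set"
  where "rep_coset p = comm_ideal +>\<^bsub>ring_of_type_algebra\<^esub> p"

lemma rep_coset_eq: "rep_coset p = {y. y - p \<in> comm_ideal}"
  unfolding rep_coset_def by (rule coset_eq[OF ideal_comm_ideal])

lemma rep_coset_eq_iff: "rep_coset p = rep_coset q \<longleftrightarrow> p - q \<in> comm_ideal"
  unfolding rep_coset_def by (rule coset_eq_iff[OF ideal_comm_ideal])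

lemma ring_rep_ring: "ring rep_ring"
  unfolding rep_ring_def by (rule ideal.quotient_is_ring[OF ideal_comm_ideal])

lemma rep_ring_simps:
  shows carrier_rep_ring: "carrier rep_ring = range rep_coset"
    and rep_coset_mult: "rep_coset p \<otimes>\<^bsub>rep_ring\<^esub> rep_coset q = rep_coset (p * q)"
    and rep_coset_add: "rep_coset p \<oplus>\<^bsub>rep_ring\<^esub> rep_coset q = rep_coset (p + q)"
    and rep_coset_one: "\<one>\<^bsub>rep_ring\<^esub> = rep_coset 1"
    and rep_coset_zero: "\<zero>\<^bsub>rep_ring\<^esub> = rep_coset 0"
proof -
  note J = ideal_comm_ideal
  show "carrier rep_ring = range rep_coset"
    by (auto simp: rep_ring_def FactRing_def A_RCOSETS_def' rep_coset_def)
  show "rep_coset p \<otimes>\<^bsub>rep_ring\<^esub> rep_coset q = rep_coset (p * q)"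
    using ideal.rcoset_mult_add[OF J, of p q] by (simp add: rep_ring_def FactRing_def rep_coset_def)
  show "rep_coset p \<oplus>\<^bsub>rep_ring\<^esub> rep_coset q = rep_coset (p + q)"
    using abelian_subgroup.a_rcos_sum[OF abelian_subgroupI3[OF ideal.axioms(1)[OF J]
          ring.is_abelian_group[OF ring_from_type_algebra]], of p q]
    by (simp add: rep_ring_def FactRing_def rep_coset_def)
  show "\<one>\<^bsub>rep_ring\<^esub> = rep_coset 1"
    by (simp add: rep_ring_def FactRing_def rep_coset_def)
  show "\<zero>\<^bsub>rep_ring\<^esub> = rep_coset 0"
    by (auto simp: rep_ring_def FactRing_def rep_coset_eq)
qed

lemma rep_coset_power: "rep_coset p [^]\<^bsub>rep_ring\<^esub> (k :: nat) = rep_coset (p ^ k)"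
proof (induction k)
  case 0
  show ?case by (simp add: nat_pow_def rep_coset_one)
next
  case (Suc k)
  have "monoid (rep_ring :: ('a, 'b) rep_poly set ring)"
    using ring_rep_ring by (rule ring.is_monoid)
  then show ?case
    using Suc by (simp add: monoid.nat_pow_Suc rep_coset_mult mult.commute)
qed

lemma diag_restriction_rep_coset: "diag_restriction (rep_coset p) = diag_subst p"
proof -
  have "diag_subst y = diag_subst p" if "y \<in> rep_coset p" for y
    using diag_subst_comm_ideal[of "y - p"] that by (simp add: rep_coset_eq diag_subst_diff)
  moreover have "p \<in> rep_coset p"
    by (simp add: rep_coset_eq ideal_zero[OF ideal_comm_ideal])
  ultimately have "diag_subst ` rep_coset p = {diag_subst p}"
    by blast
  then show ?thesis
    by (simp add: diag_restriction_def)
qed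

lemma GL_act_rep_coset:
  fixes p :: "('m::finite, 'n::finite) rep_poly"
  assumes g: "invertible g"
  shows "GL_act g ` rep_coset p = rep_coset (GL_act g p)"
proof
  show "GL_act g ` rep_coset p \<subseteq> rep_coset (GL_act g p)"
    using GL_act_comm_ideal[OF g] by (auto simp: rep_coset_eq GL_act_diff[symmetric])
  show "rep_coset (GL_act g p) \<subseteq> GL_act g ` rep_coset p"
  proof
    fix z assume z: "z \<in> rep_coset (GL_act g p)"
    have inv: "invertible (matrix_inv g)" "matrix_inv (matrix_inv g) = g"
      using matrix_inv_eqI[OF matrix_inv_mult(2,1)[OF g]] by simp_all
    have "GL_act (matrix_inv g) (z - GL_act g p) \<in> comm_ideal"
      using z by (intro GL_act_comm_ideal[OF inv(1)]) (simp add: rep_coset_eq)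
    moreover have "GL_act (matrix_inv g) (GL_act g p) = p"
      using GL_act_matrix_inv[OF inv(1)] by (simp add: inv(2))
    ultimately have "GL_act (matrix_inv g) z \<in> rep_coset p"
      by (simp add: GL_act_diff rep_coset_eq)
    then show "z \<in> GL_act g ` rep_coset p"
      using GL_act_matrix_inv[OF g, of z] by (metis imageI)
  qed
qed

lemma rep_coset_in_GL_invariants_iff:
  fixes p :: "('m::finite, 'n::finite) rep_poly"
  shows "rep_coset p \<in> GL_invariants \<longleftrightarrow>
    (\<forall>g :: complex ^ 'n ^ 'n. invertible g \<longrightarrow> GL_act g p - p \<in> comm_ideal)"
  by (auto simp: GL_invariants_def carrier_rep_ring GL_act_rep_coset rep_coset_eq_iff)

lemma GL_invariants_subset_range: "GL_invariants \<subseteq> range rep_coset"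
  by (auto simp: GL_invariants_def carrier_rep_ring)

lemma diag_subst_in_Sn_invariants:
  fixes p :: "('m::finite, 'n::finite) rep_poly"
  assumes "rep_coset p \<in> GL_invariants"
  shows "diag_subst p \<in> Sn_invariants"
proof -
  have "Sn_act \<pi> (diag_subst p) = diag_subst p" if \<pi>: "\<pi> permutes UNIV" for \<pi> :: "'n \<Rightarrow> 'n"
  proof -
    obtain g :: "complex ^ 'n ^ 'n" where g: "invertible g"
      and eq: "\<And>f :: ('m, 'n) rep_poly. diag_subst (GL_act g f) = Sn_act \<pi> (diag_subst f)"
      using ex_GL_realizing_permutation[OF \<pi>] by blast
    have "diag_subst (GL_act g p - p) = 0"
      using assms g by (intro diag_subst_comm_ideal) (simp add: rep_coset_in_GL_invariants_iff)
    then show ?thesis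
      by (simp add: diag_subst_diff eq)
  qed
  then show ?thesis
    by (simp add: Sn_invariants_def)
qed

text \<open>Modulo the ideal \<open>p\<close> is a combination \<open>q\<close> of products of
  traces, which the section recovers from its restriction. That restriction is 0, so
  \<open>q\<close> lies in the ideal, and then so does \<open>p\<close>.\<close>

lemma diag_subst_eq_0_imp_comm_ideal:
  fixes p :: "('m::finite, 'n::finite) rep_poly"
  assumes "rep_coset p \<in> GL_invariants" "diag_subst p = 0"
  shows "p \<in> comm_ideal"
proof -
  note J = ideal_comm_ideal
  obtain q where q: "q \<in> trace_span" "p - q \<in> comm_ideal"
    using GL_invariant_mod_comm_ideal_trace_span[of p] assms(1)
    by (auto simp: rep_coset_in_GL_invariants_iff)
  have "diag_subst q = 0"
    using diag_subst_comm_ideal[OF q(2)] assms(2) by (simp add: diag_subst_diff)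
  then have "trace_section 0 - q \<in> comm_ideal"
    using trace_section_diag_subst[OF q(1)] by simp
  then have "q \<in> comm_ideal"
    using ideal_uminus[OF J, of "- q"] by (simp add: trace_section_def)
  then show ?thesis
    using ideal_add[OF J q(2), of q] by simp
qed

lemma trace_section_of_Sn_invariant:
  fixes h :: "('m::finite, 'n::finite) diag_poly"
  assumes "h \<in> Sn_invariants"
  shows "rep_coset (trace_section h) \<in> GL_invariants" "diag_subst (trace_section h) = h"
proof -
  show "rep_coset (trace_section h) \<in> GL_invariants"
    by (simp add: rep_coset_in_GL_invariants_iff GL_act_trace_section ideal_zero[OF ideal_comm_ideal])
  have "(\<Sum>\<sigma> | \<sigma> permutes UNIV. Sn_act \<sigma> h) = (\<Sum>\<sigma> | \<sigma> permutes (UNIV :: 'n set). h)"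
    using assms by (intro sum.cong) (auto simp: Sn_invariants_def)
  also have "\<dots> = of_nat (fact CARD('n)) * h"
    by (simp add: card_permutations[OF refl finite_class.finite_UNIV])
  also have "Const (1 / fact CARD('n)) * \<dots> = Const (1 / fact CARD('n) * of_nat (fact CARD('n))) * h"
    by (simp only: Const_mult Const_of_nat mult.assoc)
  also have "\<dots> = h"
    by simp
  finally show "diag_subst (trace_section h) = h"
    by (simp only: diag_subst_trace_section)
qed

lemma surj_diag_subst: "surj (diag_subst :: ('m::finite, 'n::finite) rep_poly \<Rightarrow> _)"
proof (rule surjI)
  fix h :: "('m, 'n) diag_poly"
  show "diag_subst (subst (\<lambda>(k, j). Var (k, j, j)) h) = h"
    by (simp add: diag_subst_def subst_subst case_prod_unfold)
qed

theorem theorem4p1: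
  shows
    "let \<rho> = (diag_restriction :: ('m::finite, 'n::finite) rep_poly set \<Rightarrow> ('m, 'n) diag_poly);
         A = (rep_ring :: ('m, 'n) rep_poly set ring);
         B = (ring_of_type_algebra :: ('m, 'n) diag_poly ring)
     in (\<rho> \<in> ring_hom A B
         \<and> (\<forall>c. \<rho> (comm_ideal +>\<^bsub>ring_of_type_algebra\<^esub> Const c) = Const c)
         \<and> \<rho> ` carrier A = carrier B)
        \<and> \<rho> \<in> ring_iso (A\<lparr>carrier := GL_invariants\<rparr>) (B\<lparr>carrier := Sn_invariants\<rparr>)
        \<and> nilradical A \<inter> GL_invariants \<subseteq> {\<zero>\<^bsub>A\<^esub>}"
proof -
  let ?\<rho> = "diag_restriction :: ('m, 'n) rep_poly set \<Rightarrow> ('m, 'n) diag_poly"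
  let ?A = "rep_ring :: ('m, 'n) rep_poly set ring"
  let ?B = "ring_of_type_algebra :: ('m, 'n) diag_poly ring"
  let ?G = "GL_invariants :: ('m, 'n) rep_poly set set"
  let ?S = "Sn_invariants :: ('m, 'n) diag_poly set"
  note simps = rep_ring_simps diag_restriction_rep_coset diag_subst_hom
  have hom: "?\<rho> \<in> ring_hom ?A ?B"
    by (rule ring_hom_memI) (auto simp: simps)
  have const: "?\<rho> (comm_ideal +>\<^bsub>ring_of_type_algebra\<^esub> Const c) = Const c" for c
    by (simp add: diag_subst_Const diag_restriction_rep_coset flip: rep_coset_def)
  have surj: "?\<rho> ` carrier ?A = carrier ?B"
    using surj_diag_subst by (simp add: carrier_rep_ring image_image diag_restriction_rep_coset)
  have "bij_betw ?\<rho> ?G ?S"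
  proof (rule bij_betw_imageI)
    show "inj_on ?\<rho> ?G"
    proof (rule inj_onI)
      fix U V assume U: "U \<in> ?G" and V: "V \<in> ?G" and eq: "?\<rho> U = ?\<rho> V"
      obtain p q where p: "U = rep_coset p" and q: "V = rep_coset q"
        using U V GL_invariants_subset_range by blast
      \<comment> \<open>Invariants are closed under subtraction, which reduces injectivity to a
        trivial kernel.\<close>
      have "GL_act g (p - q) - (p - q) \<in> comm_ideal" if "invertible g" for g :: "complex ^ 'n ^ 'n"
        using U V that ideal_diff[OF ideal_comm_ideal, of "GL_act g p - p" "GL_act g q - q"]
        by (simp add: p q rep_coset_in_GL_invariants_iff GL_act_diff algebra_simps)
      then have "rep_coset (p - q) \<in> ?G"
        by (simp add: rep_coset_in_GL_invariants_iff)
      moreover have "diag_subst (p - q) = 0"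
        using eq by (simp add: p q diag_restriction_rep_coset diag_subst_diff)
      ultimately show "U = V"
        using diag_subst_eq_0_imp_comm_ideal by (simp add: p q rep_coset_eq_iff)
    qed
    show "?\<rho> ` ?G = ?S"
    proof
      show "?\<rho> ` ?G \<subseteq> ?S"
        using GL_invariants_subset_range diag_subst_in_Sn_invariants
        by (fastforce simp: diag_restriction_rep_coset)
      show "?S \<subseteq> ?\<rho> ` ?G"
      proof
        fix h assume "h \<in> ?S"
        then show "h \<in> ?\<rho> ` ?G"
          using trace_section_of_Sn_invariant[of h] diag_restriction_rep_coset by (metis imageI)
      qed
    qed
  qed
  moreover from this have "?\<rho> U \<in> ?S" if "U \<in> ?G" for U
    using that by (rule bij_betwE[THEN bspec])
  then have "?\<rho> \<in> ring_hom (?A\<lparr>carrier := ?G\<rparr>) (?B\<lparr>carrier := ?S\<rparr>)"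
    using hom GL_invariants_def by (intro ring_hom_memI) (auto simp: ring_hom_def GL_invariants_def)
  ultimately have iso: "?\<rho> \<in> ring_iso (?A\<lparr>carrier := ?G\<rparr>) (?B\<lparr>carrier := ?S\<rparr>)"
    by (simp add: ring_iso_def)
  have nil: "nilradical ?A \<inter> ?G \<subseteq> {\<zero>\<^bsub>?A\<^esub>}"
  proof
    fix U assume U: "U \<in> nilradical ?A \<inter> ?G"
    then obtain p k where p: "U = rep_coset p" and k: "U [^]\<^bsub>?A\<^esub> (k :: nat) = \<zero>\<^bsub>?A\<^esub>"
      by (auto simp: nilradical_def carrier_rep_ring)
    have "p ^ k \<in> comm_ideal"
      using k by (simp add: p rep_coset_power rep_coset_zero rep_coset_eq_iff)
    \<comment> \<open>A nilpotent class restricts to a nilpotent polynomial, hence to 0; injectivity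
      on invariants then finishes.\<close>
    then have "diag_subst p ^ k = 0"
      by (simp flip: diag_subst_power add: diag_subst_comm_ideal)
    then have "p \<in> comm_ideal"
      using U cpoly_power_eq_0 diag_subst_eq_0_imp_comm_ideal by (auto simp: p)
    then show "U \<in> {\<zero>\<^bsub>?A\<^esub>}"
      by (simp add: p rep_coset_zero rep_coset_eq_iff)
  qed
  show ?thesis
    unfolding Let_def using hom const surj iso nil by blast
qed

end
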